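(* Let $K=\mathbb{F}_q$ be a finite field, let $v_1,\ldots,v_n$ be positive integers, and let $X\subset\mathbb{P}^{n-1}$ be the degenerate projective torus parameterized by $x_1^{v_1},\ldots,x_n^{v_n}$, with vanishing ideal $I(X)\subset S=K[t_1,\ldots,t_n]$. Let $\beta$ be a generator of the cyclic group $K^*$, let $d_i$ be the order of $\beta^{v_i}$ in $K^*$, and let $P\subset S$ be the toric ideal of $K[y_1^{d_1},\ldots,y_1^{d_n}]$. Then: (a) If $I(X)$ is a complete intersection generated by binomials $h_1,\ldots,h_{n-1}$, then $P$ is a complete intersection generated by binomials $g_1,\ldots,g_{n-1}$ such that $h_i=g_i(t_1^{d_1},\ldots,t_n^{d_n})$ for all $i$. (b) If $P$ is a complete intersection generated by binomials $g_1,\ldots,g_{n-1}$, then $I(X)$ is a complete intersection generated by the binomials $h_1,\ldots,h_{n-1}$, where $h_i=g_i(t_1^{d_1},\ldots,t_n^{d_n})$ for all $i$.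
   Context: $X=\{[(x_1^{v_1},\ldots,x_n^{v_n})] : x_i\in K^*\text{ for all }i\}\subset\mathbb{P}^{n-1}$, where $\mathbb{P}^{n-1}$ is the projective space over $K$ and $K^*=K\setminus\{0\}$. $S=K[t_1,\ldots,t_n]$ has the standard grading, and $I(X)$ is the ideal of $S$ generated by the homogeneous polynomials that vanish at all points of $X$. The toric ideal $P$ is the kernel of the $K$-algebra epimorphism $S\to K[y_1^{d_1},\ldots,y_1^{d_n}]\subset K[y_1]$, $t_i\mapsto y_1^{d_i}$, where $K[y_1]$ is a polynomial ring in one variable. A binomial is a polynomial of the form $t^a-t^b$ with $a,b\in\mathbb{N}^n$, where $t^a=t_1^{a_1}\cdots t_n^{a_n}$. An ideal $I\subset S$ is a complete intersection if $I=(f_1,\ldots,f_m)$ for some $f_1,\ldots,f_m\in S$ with $m=\mathrm{ht}(I)$. Both $P$ and $I(X)$ have height $n-1$. *)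

theory Defs
  imports
    "HOL-Library.Poly_Mapping"
    "HOL-Library.Extended_Nat"
    "HOL-Library.Cardinality"
    "HOL-Computational_Algebra.Polynomial"
begin

section \<open>Ideals, height and complete intersections\<close>

text \<open>
  A commutative ring is a module over itself, and its ideals are the submodules.
\<close>

lemma module_times: "module ((*) :: 'a::comm_ring_1 \<Rightarrow> 'a \<Rightarrow> 'a)"
  by standard (simp_all add: algebra_simps)

definition is_ideal :: "'a::comm_ring_1 set \<Rightarrow> bool" where
  "is_ideal I \<longleftrightarrow> module.subspace (*) I"

definition ideal_gen :: "'a::comm_ring_1 set \<Rightarrow> 'a set" where
  "ideal_gen B = module.span (*) B"

definition is_prime_ideal :: "'a::comm_ring_1 set \<Rightarrow> bool" where
  "is_prime_ideal p \<longleftrightarrow>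
     is_ideal p \<and> p \<noteq> UNIV \<and> (\<forall>a b. a * b \<in> p \<longrightarrow> a \<in> p \<or> b \<in> p)"

definition is_prime_chain :: "(nat \<Rightarrow> 'a::comm_ring_1 set) \<Rightarrow> nat \<Rightarrow> bool" where
  "is_prime_chain c k \<longleftrightarrow> (\<forall>i\<le>k. is_prime_ideal (c i)) \<and> (\<forall>i<k. c i \<subset> c (Suc i))"

definition prime_height :: "'a::comm_ring_1 set \<Rightarrow> enat" where
  "prime_height p = (SUP k\<in>{k. \<exists>c. is_prime_chain c k \<and> c k = p}. enat k)"

definition height :: "'a::comm_ring_1 set \<Rightarrow> enat" where
  "height I = (INF p\<in>{p. is_prime_ideal p \<and> I \<subseteq> p}. prime_height p)"

definition complete_intersection :: "'a::comm_ring_1 set \<Rightarrow> bool" where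
  "complete_intersection I \<longleftrightarrow>
     (\<exists>m f. I = ideal_gen (f ` {1..m}) \<and> height I = enat m)"

section \<open>Polynomials in several variables\<close>

text \<open>
  The polynomial ring in the variables \<open>t i\<close>, for \<open>i\<close> in the finite type \<open>'n\<close>, is the monoid
  algebra of the additive monoid \<open>'n \<Rightarrow>\<^sub>0 nat\<close> of exponent vectors; multiplication of finitely
  supported functions is convolution.
\<close>

type_synonym ('n, 'k) mvpoly = "('n \<Rightarrow>\<^sub>0 nat) \<Rightarrow>\<^sub>0 'k"

definition mv_monom :: "('n \<Rightarrow>\<^sub>0 nat) \<Rightarrow> ('n, 'k::comm_ring_1) mvpoly" where
  "mv_monom a = Poly_Mapping.single a 1"

definition mv_const :: "'k::comm_ring_1 \<Rightarrow> ('n, 'k) mvpoly" where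
  "mv_const c = Poly_Mapping.single 0 c"

definition mv_var :: "'n \<Rightarrow> ('n, 'k::comm_ring_1) mvpoly" where
  "mv_var i = mv_monom (Poly_Mapping.single i 1)"

definition is_binomial :: "('n, 'k::comm_ring_1) mvpoly \<Rightarrow> bool" where
  "is_binomial f \<longleftrightarrow> (\<exists>a b. f = mv_monom a - mv_monom b)"

definition homogeneous :: "('n::finite, 'k::comm_ring_1) mvpoly \<Rightarrow> bool" where
  "homogeneous f \<longleftrightarrow>
     (\<exists>e. \<forall>a\<in>Poly_Mapping.keys f. (\<Sum>i\<in>UNIV. Poly_Mapping.lookup a i) = e)"

text \<open>
  For a ring homomorphism \<open>\<phi>\<close> from the coefficients to a commutative ring, \<open>mv_eval \<phi> x\<close> is the
  homomorphism that extends \<open>\<phi>\<close> and sends each \<open>t i\<close> to \<open>x i\<close>.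
\<close>

definition mv_eval ::
  "('k::comm_ring_1 \<Rightarrow> 'a::comm_ring_1) \<Rightarrow> ('n::finite \<Rightarrow> 'a) \<Rightarrow> ('n, 'k) mvpoly \<Rightarrow> 'a" where
  "mv_eval \<phi> x f =
     (\<Sum>a\<in>Poly_Mapping.keys f.
        \<phi> (Poly_Mapping.lookup f a) * (\<Prod>i\<in>UNIV. x i ^ Poly_Mapping.lookup a i))"

definition subst_powers ::
  "('n::finite \<Rightarrow> nat) \<Rightarrow> ('n, 'k::comm_ring_1) mvpoly \<Rightarrow> ('n, 'k) mvpoly" where
  "subst_powers d g = mv_eval mv_const (\<lambda>i. mv_var i ^ d i) g"

section \<open>Vanishing ideals of projective sets\<close>

text \<open>
  The point \<open>[x]\<close> of projective space is the class of \<open>x \<noteq> 0\<close> under scaling by units.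
\<close>

definition proj_point :: "('n \<Rightarrow> 'k::field) \<Rightarrow> ('n \<Rightarrow> 'k) set" where
  "proj_point x = {\<lambda>i. c * x i | c. c \<noteq> 0}"

definition vanishes_at ::
  "('n::finite, 'k::field) mvpoly \<Rightarrow> ('n \<Rightarrow> 'k) set \<Rightarrow> bool" where
  "vanishes_at f Q \<longleftrightarrow> (\<forall>x\<in>Q. mv_eval (\<lambda>c. c) x f = 0)"

definition vanishing_ideal ::
  "('n::finite \<Rightarrow> 'k::field) set set \<Rightarrow> ('n, 'k) mvpoly set" where
  "vanishing_ideal X = ideal_gen {f. homogeneous f \<and> (\<forall>Q\<in>X. vanishes_at f Q)}"

definition degenerate_torus :: "('n \<Rightarrow> nat) \<Rightarrow> ('n \<Rightarrow> 'k::field) set set" where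
  "degenerate_torus v = {proj_point (\<lambda>i. x i ^ v i) | x. \<forall>i. x i \<noteq> 0}"

section \<open>The toric ideal and the multiplicative group\<close>

definition toric_ideal :: "('n::finite \<Rightarrow> nat) \<Rightarrow> ('n, 'k::field) mvpoly set" where
  "toric_ideal d = {f. mv_eval (\<lambda>c. [:c:]) (\<lambda>i. Polynomial.monom 1 (d i)) f = 0}"

definition generates_units :: "'k::field \<Rightarrow> bool" where
  "generates_units \<beta> \<longleftrightarrow> {\<beta> ^ k | k::nat. True} = {x. x \<noteq> 0}"

definition mult_order :: "'k::field \<Rightarrow> nat" where
  "mult_order x = (LEAST k. 0 < k \<and> x ^ k = 1)"

end

theory Submission
  imports Defs "HOL-Analysis.Cartesian_Space"
begin

text \<open>
  The idea: \<open>P\<close> is spanned by the binomials \<open>t^a - t^b\<close> with \<open>\<Sum> d i * a i = \<Sum> d i * b i\<close>, and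
  orthogonality of the characters of the torus shows that \<open>I(X)\<close> is spanned by the binomials
  \<open>t^a - t^b\<close> with \<open>a\<close>, \<open>b\<close> of equal degree and congruent modulo \<open>d\<close>. Such a binomial is a monomial
  times the image of a binomial of \<open>P\<close> under \<open>t i \<mapsto> t i ^ d i\<close>, so \<open>I(X)\<close> is the extension of \<open>P\<close>
  along this substitution, which is free and therefore reflects equality of ideals. This gives (b),
  and also (a) once the \<open>h i\<close> are known to lie in the image of the substitution, that is, to have no
  monomial factor. Otherwise \<open>CARD('n) - 2\<close> vectors would suffice to span the lattice of \<open>I(X)\<close>
  over \<open>\<real>\<close>, which has rank \<open>CARD('n) - 1\<close>. Both ideals have height \<open>CARD('n) - 1\<close>: lower bounds
  come from explicit chains of primes, and the upper bound from counting residue classes of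
  polynomials of bounded degree over the finite field.
\<close>

section \<open>Ideals, ring homomorphisms and evaluation\<close>

lemma is_ideal_iff:
  "is_ideal I \<longleftrightarrow> 0 \<in> I \<and> (\<forall>x\<in>I. \<forall>y\<in>I. x + y \<in> I) \<and> (\<forall>c. \<forall>x\<in>I. c * x \<in> I)"
  unfolding is_ideal_def using module.subspace_def[OF module_times] by auto

lemma ideal_zero: "is_ideal I \<Longrightarrow> 0 \<in> I"
  and ideal_add: "is_ideal I \<Longrightarrow> x \<in> I \<Longrightarrow> y \<in> I \<Longrightarrow> x + y \<in> I"
  and ideal_mult: "is_ideal I \<Longrightarrow> x \<in> I \<Longrightarrow> c * x \<in> I"
  by (auto simp: is_ideal_iff)

lemma ideal_mult_right: "is_ideal I \<Longrightarrow> x \<in> I \<Longrightarrow> x * c \<in> I"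
  using ideal_mult[of I x c] by (simp add: mult.commute)

lemma ideal_uminus: "is_ideal I \<Longrightarrow> x \<in> I \<Longrightarrow> - x \<in> I"
  using ideal_mult[of I x "-1"] by simp

lemma ideal_diff: "is_ideal I \<Longrightarrow> x \<in> I \<Longrightarrow> y \<in> I \<Longrightarrow> x - y \<in> I"
  using ideal_add[of I x "-y"] ideal_uminus[of I y] by simp

lemma ideal_sum: "is_ideal I \<Longrightarrow> (\<And>x. x \<in> A \<Longrightarrow> f x \<in> I) \<Longrightarrow> sum f A \<in> I"
  by (induction A rule: infinite_finite_induct) (auto simp: ideal_zero ideal_add)

lemma is_ideal_ideal_gen: "is_ideal (ideal_gen B)"
  unfolding is_ideal_def ideal_gen_def by (rule module.subspace_span[OF module_times])

lemma ideal_gen_base: "b \<in> B \<Longrightarrow> b \<in> ideal_gen B"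
  unfolding ideal_gen_def by (rule module.span_base[OF module_times])

lemma ideal_gen_minimal: "B \<subseteq> I \<Longrightarrow> is_ideal I \<Longrightarrow> ideal_gen B \<subseteq> I"
  unfolding ideal_gen_def is_ideal_def by (rule module.span_minimal[OF module_times])

lemma ideal_gen_ideal: "is_ideal I \<Longrightarrow> ideal_gen I = I"
  using ideal_gen_minimal[of I I] ideal_gen_base[of _ I] by blast

lemma ideal_gen_eqI: "A \<subseteq> ideal_gen B \<Longrightarrow> B \<subseteq> ideal_gen A \<Longrightarrow> ideal_gen A = ideal_gen B"
  by (simp add: ideal_gen_minimal is_ideal_ideal_gen subset_antisym)

lemma ideal_congruent_power:
  assumes "is_ideal I" "x - y \<in> I"
  shows "x ^ n - y ^ n \<in> I"
  using ideal_mult_right[OF assms] by (simp add: power_diff_sumr2)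

lemma ideal_congruent_mult:
  assumes "is_ideal I" "x - y \<in> I" "u - w \<in> I"
  shows "x * u - y * w \<in> I"
proof -
  have "x * u - y * w = (x - y) * u + y * (u - w)" by (simp add: algebra_simps)
  then show ?thesis using assms by (simp add: ideal_add ideal_mult ideal_mult_right)
qed

lemma ideal_congruent_prod:
  assumes "is_ideal I" "\<And>i. i \<in> A \<Longrightarrow> f i - g i \<in> I"
  shows "prod f A - prod g A \<in> I"
  using assms(2)
  by (induction A rule: infinite_finite_induct)
    (auto simp: ideal_zero[OF assms(1)] intro!: ideal_congruent_mult[OF assms(1)])

section \<open>Ring homomorphisms and extension of ideals along them\<close>

definition ring_map :: "('a::comm_ring_1 \<Rightarrow> 'b::comm_ring_1) \<Rightarrow> bool" where
  "ring_map \<phi> \<longleftrightarrow>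
     \<phi> 1 = 1 \<and> (\<forall>a b. \<phi> (a + b) = \<phi> a + \<phi> b) \<and> (\<forall>a b. \<phi> (a * b) = \<phi> a * \<phi> b)"

lemma ring_map_one: "ring_map \<phi> \<Longrightarrow> \<phi> 1 = 1"
  and ring_map_add: "ring_map \<phi> \<Longrightarrow> \<phi> (a + b) = \<phi> a + \<phi> b"
  and ring_map_mult: "ring_map \<phi> \<Longrightarrow> \<phi> (a * b) = \<phi> a * \<phi> b"
  by (auto simp: ring_map_def)

lemma ring_map_zero: "ring_map \<phi> \<Longrightarrow> \<phi> 0 = 0"
  using ring_map_add[of \<phi> 0 0] by simp

lemma ring_map_diff: "ring_map \<phi> \<Longrightarrow> \<phi> (a - b) = \<phi> a - \<phi> b"
  using ring_map_add[of \<phi> "a - b" b] by simp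

lemma ring_map_prod: "ring_map \<phi> \<Longrightarrow> \<phi> (prod f A) = (\<Prod>x\<in>A. \<phi> (f x))"
  by (induction A rule: infinite_finite_induct) (auto simp: ring_map_one ring_map_mult)

lemma ring_map_power: "ring_map \<phi> \<Longrightarrow> \<phi> (a ^ n) = \<phi> a ^ n"
  by (induction n) (auto simp: ring_map_one ring_map_mult)

lemma ring_map_comp: "ring_map \<phi> \<Longrightarrow> ring_map \<psi> \<Longrightarrow> ring_map (\<lambda>x. \<psi> (\<phi> x))"
  by (simp add: ring_map_def)

lemma ring_map_ident: "ring_map (\<lambda>c. c)"
  by (simp add: ring_map_def)

lemma ring_map_pCons: "ring_map (\<lambda>c. [:c:])"
  by (simp add: ring_map_def)

lemma ring_map_single_zero:
  "ring_map (Poly_Mapping.single 0 :: 'k::comm_ring_1 \<Rightarrow> ('m::comm_monoid_add \<Rightarrow>\<^sub>0 'k))"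
  by (simp add: ring_map_def single_add mult_single)

lemma ring_map_mv_const: "ring_map mv_const"
  using ring_map_single_zero by (simp add: mv_const_def[abs_def])

lemma is_ideal_kernel: "ring_map \<phi> \<Longrightarrow> is_ideal {f. \<phi> f = 0}"
  by (simp add: is_ideal_iff ring_map_zero ring_map_add ring_map_mult)

lemma is_prime_ideal_kernel:
  fixes \<phi> :: "'a::comm_ring_1 \<Rightarrow> 'b::comm_ring_1"
  assumes "ring_map \<phi>" and "\<And>x y :: 'b. x * y = 0 \<Longrightarrow> x = 0 \<or> y = 0"
  shows "is_prime_ideal {f. \<phi> f = 0}"
proof -
  have "1 \<notin> {f. \<phi> f = 0}" using assms(1) by (simp add: ring_map_one)
  then show ?thesis
    using assms(2) by (auto simp: is_prime_ideal_def is_ideal_kernel ring_map_mult assms(1))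
qed

text \<open>The preimage of an ideal under a ring homomorphism is an ideal, so it contains
  \<open>ideal_gen B\<close> once it contains \<open>B\<close>. Hence the extension of an ideal does
  not depend on the chosen generators.\<close>

lemma ideal_gen_image_cong:
  assumes "ring_map \<phi>" and "ideal_gen A = ideal_gen B"
  shows "ideal_gen (\<phi> ` A) = ideal_gen (\<phi> ` B)"
proof -
  have sub: "\<phi> ` A \<subseteq> ideal_gen (\<phi> ` B)" if "ideal_gen A = ideal_gen B" for A B
  proof -
    have "is_ideal {f. \<phi> f \<in> ideal_gen (\<phi> ` B)}"
      using is_ideal_ideal_gen[of "\<phi> ` B"] assms(1)
      by (simp add: is_ideal_iff ring_map_zero ring_map_add ring_map_mult)
    moreover have "B \<subseteq> {f. \<phi> f \<in> ideal_gen (\<phi> ` B)}"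
      by (auto intro: ideal_gen_base)
    ultimately have "ideal_gen B \<subseteq> {f. \<phi> f \<in> ideal_gen (\<phi> ` B)}"
      by (rule ideal_gen_minimal[rotated])
    then show ?thesis using that ideal_gen_base[of _ A] by auto
  qed
  show ?thesis by (rule ideal_gen_eqI) (simp_all add: sub assms(2))
qed

text \<open>Additive statements need only be checked on scalar multiples of monomials. The zero
  function needs no case of its own, being \<open>single\<close> with coefficient 0.\<close>

lemma poly_mapping_add_induct [case_names single add]:
  fixes f :: "'a \<Rightarrow>\<^sub>0 'b::ab_group_add"
  assumes "\<And>a c. P (Poly_Mapping.single a c)" "\<And>f g. P f \<Longrightarrow> P g \<Longrightarrow> P (f + g)"
  shows "P f"
proof (induction f rule: update_induct)
  case const
  then show ?case using assms(1)[of undefined 0] by simp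
next
  case (update f a b)
  have "Poly_Mapping.update a b f = f + Poly_Mapping.single a b"
    using update(1) by (intro poly_mapping_eqI)
      (auto simp: lookup_update lookup_add lookup_single when_def in_keys_iff)
  then show ?case using assms update by simp
qed

lemma poly_mapping_sum_single:
  "(\<Sum>a\<in>Poly_Mapping.keys f. Poly_Mapping.single a (Poly_Mapping.lookup f a)) = f"
  by (rule poly_mapping_eqI) (auto simp: lookup_sum lookup_single when_def in_keys_iff)

section \<open>Evaluation homomorphisms on polynomials\<close>

lemma mv_eval_superset:
  assumes "ring_map \<phi>" "finite A" "Poly_Mapping.keys f \<subseteq> A"
  shows "mv_eval \<phi> x f =
    (\<Sum>a\<in>A. \<phi> (Poly_Mapping.lookup f a) * (\<Prod>i\<in>UNIV. x i ^ Poly_Mapping.lookup a i))"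
  unfolding mv_eval_def using assms
  by (intro sum.mono_neutral_left) (auto simp: in_keys_iff ring_map_zero)

lemma mv_eval_add:
  assumes "ring_map \<phi>"
  shows "mv_eval \<phi> x (f + g) = mv_eval \<phi> x f + mv_eval \<phi> x g"
proof -
  \<comment> \<open>All three sums are taken over the union of the supports, so that cancellation in
    \<open>f + g\<close> does no harm.\<close>
  let ?A = "Poly_Mapping.keys f \<union> Poly_Mapping.keys g"
  have "Poly_Mapping.keys (f + g) \<subseteq> ?A" by (rule keys_add)
  then show ?thesis
    by (simp add: mv_eval_superset[OF assms, of ?A] lookup_add ring_map_add[OF assms]
        distrib_right sum.distrib)
qed

lemma mv_eval_single:
  assumes "ring_map \<phi>"
  shows "mv_eval \<phi> x (Poly_Mapping.single a c) = \<phi> c * (\<Prod>i\<in>UNIV. x i ^ Poly_Mapping.lookup a i)"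
  using mv_eval_superset[OF assms, of "{a}" "Poly_Mapping.single a c" x] by auto

lemma mv_eval_mult:
  assumes "ring_map \<phi>"
  shows "mv_eval \<phi> x (f * g) = mv_eval \<phi> x f * mv_eval \<phi> x g"
proof (induction f rule: poly_mapping_add_induct)
  case (single a c)
  show ?case
    by (induction g rule: poly_mapping_add_induct)
      (simp_all add: mult_single mv_eval_single[OF assms] ring_map_mult[OF assms] lookup_add
        power_add prod.distrib algebra_simps mv_eval_add[OF assms])
qed (simp add: mv_eval_add[OF assms] distrib_right)

lemma ring_map_mv_eval: "ring_map \<phi> \<Longrightarrow> ring_map (mv_eval \<phi> x)"
  by (simp add: ring_map_def[of "mv_eval \<phi> x"] mv_eval_add mv_eval_mult
      mv_eval_single[of \<phi> x 0 1, simplified] ring_map_one)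

lemma mv_eval_monom:
  "ring_map \<phi> \<Longrightarrow> mv_eval \<phi> x (mv_monom a) = (\<Prod>i\<in>UNIV. x i ^ Poly_Mapping.lookup a i)"
  by (simp add: mv_monom_def mv_eval_single ring_map_one)

lemma mv_eval_const: "ring_map \<phi> \<Longrightarrow> mv_eval \<phi> x (mv_const c) = \<phi> c"
  by (simp add: mv_const_def mv_eval_single)

lemma prod_power_single:
  fixes x :: "'n::finite \<Rightarrow> 'a::comm_ring_1"
  shows "(\<Prod>i\<in>UNIV. x i ^ Poly_Mapping.lookup (Poly_Mapping.single j m) i) = x j ^ m"
proof -
  have "(\<Prod>i\<in>UNIV. x i ^ Poly_Mapping.lookup (Poly_Mapping.single j m) i) =
      (\<Prod>i\<in>UNIV. if i = j then x j ^ m else 1)"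
    by (rule prod.cong) (auto simp: lookup_single when_def)
  then show ?thesis by simp
qed

lemma mv_eval_var: "ring_map \<phi> \<Longrightarrow> mv_eval \<phi> x (mv_var j) = x j"
  by (simp add: mv_var_def mv_eval_monom prod_power_single)

lemma mv_monom_add: "mv_monom (a + b) = mv_monom a * mv_monom b"
  by (simp add: mv_monom_def mult_single)

lemma mv_monom_zero: "mv_monom 0 = 1"
  by (simp add: mv_monom_def)

lemma mv_const_mult_monom: "mv_const c * mv_monom a = Poly_Mapping.single a c"
  by (simp add: mv_monom_def mv_const_def mult_single)

lemma mv_var_power: "mv_var j ^ m = mv_monom (Poly_Mapping.single j m)"
proof (induction m)
  case (Suc m)
  have "Poly_Mapping.single j (Suc m) = Poly_Mapping.single j 1 + Poly_Mapping.single j m"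
    by (simp flip: single_add)
  then show ?case using Suc by (simp add: mv_monom_add mv_var_def)
qed (simp add: mv_monom_zero)

lemma prod_mv_monom: "finite A \<Longrightarrow> (\<Prod>i\<in>A. mv_monom (f i)) = mv_monom (\<Sum>i\<in>A. f i)"
  by (induction A rule: finite_induct) (auto simp: mv_monom_zero mv_monom_add)

text \<open>Every monomial is a product of variables, so constants and variables determine a
  homomorphism. Identities between composed substitutions are proved this way.\<close>

lemma ring_map_mv_ext:
  fixes \<phi> \<psi> :: "('n::finite, 'k::comm_ring_1) mvpoly \<Rightarrow> 'a::comm_ring_1"
  assumes "ring_map \<phi>" "ring_map \<psi>" "\<And>c. \<phi> (mv_const c) = \<psi> (mv_const c)"
    "\<And>i. \<phi> (mv_var i) = \<psi> (mv_var i)"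
  shows "\<phi> f = \<psi> f"
proof (induction f rule: poly_mapping_add_induct)
  case (single a c)
  have a: "a = (\<Sum>i\<in>UNIV. Poly_Mapping.single i (Poly_Mapping.lookup a i))"
    by (rule poly_mapping_eqI) (simp add: lookup_sum lookup_single when_def)
  have "mv_monom a = (\<Prod>i\<in>UNIV. mv_var i ^ Poly_Mapping.lookup a i :: ('n, 'k) mvpoly)"
    by (subst a) (simp add: mv_var_power prod_mv_monom)
  then show ?case
    by (simp add: ring_map_mult ring_map_prod ring_map_power assms flip: mv_const_mult_monom)
qed (simp add: assms ring_map_add)

section \<open>Binomial ideals and class sums\<close>

text \<open>The coefficient at w of the pushforward of f along \<kappa>. No structure on the classes
  is assumed, so \<kappa> can return a weight, a family of residues or a coset.\<close>

definition class_sum ::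
  "('m \<Rightarrow> 'c) \<Rightarrow> ('m \<Rightarrow>\<^sub>0 'k::ab_group_add) \<Rightarrow> 'c \<Rightarrow> 'k" where
  "class_sum \<kappa> f w = (\<Sum>a | a \<in> Poly_Mapping.keys f \<and> \<kappa> a = w. Poly_Mapping.lookup f a)"

lemma class_sum_superset:
  assumes "finite A" "Poly_Mapping.keys f \<subseteq> A"
  shows "class_sum \<kappa> f w = (\<Sum>a | a \<in> A \<and> \<kappa> a = w. Poly_Mapping.lookup f a)"
  unfolding class_sum_def using assms
  by (intro sum.mono_neutral_left) (auto simp: in_keys_iff)

lemma class_sum_add: "class_sum \<kappa> (f + g) w = class_sum \<kappa> f w + class_sum \<kappa> g w"
proof -
  let ?A = "Poly_Mapping.keys f \<union> Poly_Mapping.keys g"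
  have "Poly_Mapping.keys (f + g) \<subseteq> ?A" by (rule keys_add)
  then show ?thesis
    by (simp add: class_sum_superset[of ?A] lookup_add sum.distrib)
qed

lemma class_sum_zero: "class_sum \<kappa> 0 w = 0"
  by (simp add: class_sum_def)

lemma class_sum_diff: "class_sum \<kappa> (f - g) w = class_sum \<kappa> f w - class_sum \<kappa> g w"
  using class_sum_add[of \<kappa> "f - g" g w] by simp

lemma class_sum_single:
  "class_sum \<kappa> (Poly_Mapping.single a c) w = (if \<kappa> a = w then c else 0)"
proof -
  have "{x. x = a \<and> \<kappa> x = w} = (if \<kappa> a = w then {a} else {})" by auto
  then show ?thesis
    using class_sum_superset[of "{a}" "Poly_Mapping.single a c" \<kappa> w] by auto
qed

text \<open>In a monomial multiple of a generator the two terms fall into the same class and cancel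
  there; linearity of class sums does the rest.\<close>

lemma class_sum_eq_0_if_mem_ideal_gen:
  fixes f :: "('n, 'k::comm_ring_1) mvpoly"
  assumes f: "f \<in> ideal_gen B"
    and B: "\<And>h. h \<in> B \<Longrightarrow> \<exists>a b. h = mv_monom a - mv_monom b \<and> (\<forall>u. \<kappa> (u + a) = \<kappa> (u + b))"
  shows "class_sum \<kappa> f w = 0"
proof -
  \<comment> \<open>Asking for vanishing on all multiples of f makes the condition stable under
    multiplication.\<close>
  let ?J = "{f. \<forall>q. class_sum \<kappa> (q * f) w = 0}"
  have "is_ideal ?J"
    by (auto simp: is_ideal_iff class_sum_zero distrib_left class_sum_add simp flip: mult.assoc)
  moreover have "B \<subseteq> ?J"
  proof
    fix h assume "h \<in> B"
    then obtain a b where h: "h = mv_monom a - mv_monom b" and ab: "\<And>u. \<kappa> (u + a) = \<kappa> (u + b)"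
      using B by blast
    have "class_sum \<kappa> (q * h) w = 0" for q
      by (induction q rule: poly_mapping_add_induct)
        (simp_all add: h mv_monom_def right_diff_distrib mult_single class_sum_diff
          class_sum_single ab distrib_right class_sum_add)
    then show "h \<in> ?J" by simp
  qed
  ultimately have "f \<in> ?J" using ideal_gen_minimal f by blast
  then have "class_sum \<kappa> (1 * f) w = 0" by blast
  then show ?thesis by simp
qed

text \<open>If the two classes differed, the class of a would have sum 1. Suitable invariants
  \<kappa> of the generators thus extract degrees, residues and cosets from membership of a
  binomial.\<close>

lemma monom_diff_mem_ideal_gen_imp_eq:
  fixes B :: "('n, 'k::comm_ring_1) mvpoly set"
  assumes "mv_monom a - mv_monom b \<in> ideal_gen B"
    and "\<And>h. h \<in> B \<Longrightarrow> \<exists>a b. h = mv_monom a - mv_monom b \<and> (\<forall>u. \<kappa> (u + a) = \<kappa> (u + b))"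
  shows "\<kappa> a = \<kappa> b"
proof (rule ccontr)
  assume "\<kappa> a \<noteq> \<kappa> b"
  then have "class_sum \<kappa> (mv_monom a - mv_monom b :: ('n, 'k) mvpoly) (\<kappa> a) = 1"
    by (simp add: mv_monom_def class_sum_diff class_sum_single)
  then show False using class_sum_eq_0_if_mem_ideal_gen[OF assms] by fastforce
qed

text \<open>Replacing each monomial of \<open>f\<close> by a representative of its class changes \<open>f\<close> by a
  combination of binomials, and turns \<open>f\<close> into the zero polynomial.\<close>

lemma mem_ideal_if_class_sums_eq_0:
  fixes f :: "('n, 'k::comm_ring_1) mvpoly"
  assumes I: "is_ideal I" and zero: "\<And>w. class_sum \<kappa> f w = 0"
    and diff: "\<And>a b. a \<in> Poly_Mapping.keys f \<Longrightarrow> b \<in> Poly_Mapping.keys f \<Longrightarrow> \<kappa> a = \<kappa> b \<Longrightarrow>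
      mv_monom a - mv_monom b \<in> I"
  shows "f \<in> I"
proof -
  let ?K = "Poly_Mapping.keys f" and ?c = "Poly_Mapping.lookup f"
  define r where "r w = (SOME a. a \<in> ?K \<and> \<kappa> a = w)" for w
  have r: "r (\<kappa> a) \<in> ?K \<and> \<kappa> (r (\<kappa> a)) = \<kappa> a" if "a \<in> ?K" for a
    unfolding r_def by (rule someI_ex) (use that in blast)
  have "(\<Sum>a\<in>?K. Poly_Mapping.single (r (\<kappa> a)) (?c a)) =
      (\<Sum>w\<in>\<kappa> ` ?K. \<Sum>a | a \<in> ?K \<and> \<kappa> a = w. Poly_Mapping.single (r (\<kappa> a)) (?c a))"
    by (rule sum.image_gen) simp
  also have "\<dots> = (\<Sum>w\<in>\<kappa> ` ?K. Poly_Mapping.single (r w) (class_sum \<kappa> f w))"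
  proof (rule sum.cong[OF refl])
    fix w
    have "(\<Sum>a\<in>A. Poly_Mapping.single (r w) (?c a)) = Poly_Mapping.single (r w) (sum ?c A)" for A
      by (induction A rule: infinite_finite_induct) (auto simp: single_add)
    from this[of "{a. a \<in> ?K \<and> \<kappa> a = w}"]
    show "(\<Sum>a | a \<in> ?K \<and> \<kappa> a = w. Poly_Mapping.single (r (\<kappa> a)) (?c a)) =
        Poly_Mapping.single (r w) (class_sum \<kappa> f w)"
      unfolding class_sum_def by simp
  qed
  finally have "(\<Sum>a\<in>?K. Poly_Mapping.single (r (\<kappa> a)) (?c a)) = 0"
    by (simp add: zero)
  then have "f = (\<Sum>a\<in>?K. Poly_Mapping.single a (?c a)) -
      (\<Sum>a\<in>?K. Poly_Mapping.single (r (\<kappa> a)) (?c a))"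
    by (simp add: poly_mapping_sum_single)
  also have "\<dots> = (\<Sum>a\<in>?K. mv_const (?c a) * (mv_monom a - mv_monom (r (\<kappa> a))))"
    by (simp add: sum_subtractf right_diff_distrib mv_const_mult_monom)
  also have "\<dots> \<in> I"
    by (intro ideal_sum ideal_mult diff I) (simp_all add: r)
  finally show ?thesis .
qed

section \<open>Weighted degrees and the toric ideal\<close>

definition weight :: "('n::finite \<Rightarrow> nat) \<Rightarrow> ('n \<Rightarrow>\<^sub>0 nat) \<Rightarrow> nat" where
  "weight d a = (\<Sum>i\<in>UNIV. d i * Poly_Mapping.lookup a i)"

lemma weight_add: "weight d (a + b) = weight d a + weight d b"
  by (simp add: weight_def lookup_add distrib_left sum.distrib)

lemma weight_single: "weight d (Poly_Mapping.single i m) = d i * m"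
proof -
  have "weight d (Poly_Mapping.single i m) = (\<Sum>j\<in>UNIV. if j = i then d i * m else 0)"
    unfolding weight_def by (rule sum.cong) (auto simp: lookup_single when_def)
  then show ?thesis by simp
qed

text \<open>The parametrization sends t^a to y^w with w the weight of a, so the class sum at w is
  the coefficient of y^w in the image of f.\<close>

lemma mem_toric_ideal_iff: "f \<in> toric_ideal d \<longleftrightarrow> (\<forall>w. class_sum (weight d) f w = 0)"
proof -
  have m: "(\<Prod>i\<in>A. Polynomial.monom (1::'b) (d i) ^ Poly_Mapping.lookup a i) =
      Polynomial.monom 1 (\<Sum>i\<in>A. d i * Poly_Mapping.lookup a i)" if "finite A" for a and A :: "'a set"
    using that by (induction A rule: finite_induct) (auto simp: monom_power mult_monom)
  have e: "mv_eval (\<lambda>c. [:c:]) (\<lambda>i. Polynomial.monom 1 (d i)) f =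
      (\<Sum>a\<in>Poly_Mapping.keys f. Polynomial.monom (Poly_Mapping.lookup f a) (weight d a))"
    by (simp add: mv_eval_def m weight_def smult_monom)
  have "coeff (mv_eval (\<lambda>c. [:c:]) (\<lambda>i. Polynomial.monom 1 (d i)) f) w =
      class_sum (weight d) f w" for w
  proof -
    have "class_sum (weight d) f w =
        (\<Sum>a\<in>Poly_Mapping.keys f. if weight d a = w then Poly_Mapping.lookup f a else 0)"
      unfolding class_sum_def by (rule sum.mono_neutral_cong_left) auto
    then show ?thesis by (simp add: e coeff_sum coeff_monom)
  qed
  then show ?thesis by (simp add: toric_ideal_def poly_eq_iff)
qed

lemma ring_map_toric: "ring_map (mv_eval (\<lambda>c. [:c:]) x)"
  by (rule ring_map_mv_eval[OF ring_map_pCons])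

lemma is_ideal_toric_ideal: "is_ideal (toric_ideal d)"
  unfolding toric_ideal_def by (rule is_ideal_kernel[OF ring_map_toric])

lemma monom_diff_mem_toric_ideal_iff:
  "mv_monom a - mv_monom b \<in> toric_ideal d \<longleftrightarrow> weight d a = weight d b"
  unfolding mem_toric_ideal_iff
  by (auto simp: mv_monom_def class_sum_diff class_sum_single split: if_splits)

lemma toric_ideal_eq_ideal_gen:
  fixes d :: "'n::finite \<Rightarrow> nat"
  shows "(toric_ideal d :: ('n, 'k::field) mvpoly set) =
    ideal_gen {mv_monom a - mv_monom b | a b. weight d a = weight d b}" (is "_ = ideal_gen ?B")
proof
  show "toric_ideal d \<subseteq> ideal_gen ?B"
  proof
    fix f :: "('n, 'k) mvpoly" assume "f \<in> toric_ideal d"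
    then show "f \<in> ideal_gen ?B"
      by - (rule mem_ideal_if_class_sums_eq_0[OF is_ideal_ideal_gen, where \<kappa> = "weight d"],
        auto simp: mem_toric_ideal_iff intro: ideal_gen_base)
  qed
  show "ideal_gen ?B \<subseteq> toric_ideal d"
    by (intro ideal_gen_minimal is_ideal_toric_ideal) (auto simp: monom_diff_mem_toric_ideal_iff)
qed

section \<open>The substitution of powers for variables, on monomials\<close>

definition scale_exponent :: "('n::finite \<Rightarrow> nat) \<Rightarrow> ('n \<Rightarrow>\<^sub>0 nat) \<Rightarrow> ('n \<Rightarrow>\<^sub>0 nat)" where
  "scale_exponent d a = (\<Sum>i\<in>UNIV. Poly_Mapping.single i (d i * Poly_Mapping.lookup a i))"

lemma lookup_scale_exponent:
  "Poly_Mapping.lookup (scale_exponent d a) i = d i * Poly_Mapping.lookup a i"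
  by (simp add: scale_exponent_def lookup_sum lookup_single when_def)

lemma weight_scale_exponent: "weight (\<lambda>_. 1) (scale_exponent d a) = weight d a"
  by (simp add: weight_def lookup_scale_exponent)

lemma ring_map_subst_powers: "ring_map (subst_powers d)"
  using ring_map_mv_eval[OF ring_map_mv_const] by (simp add: subst_powers_def[abs_def])

lemma subst_powers_monom: "subst_powers d (mv_monom a) = mv_monom (scale_exponent d a)"
  by (simp only: subst_powers_def mv_eval_monom[OF ring_map_mv_const] power_mult[symmetric])
    (simp add: mv_var_power prod_mv_monom scale_exponent_def)

lemma subst_powers_const: "subst_powers d (mv_const c) = mv_const c"
  by (simp add: subst_powers_def mv_eval_const[OF ring_map_mv_const])

lemma subst_powers_single:
  "subst_powers d (Poly_Mapping.single a c) = Poly_Mapping.single (scale_exponent d a) c"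
  using ring_map_mult[OF ring_map_subst_powers, of d "mv_const c" "mv_monom a"]
  by (simp add: mv_const_mult_monom subst_powers_monom subst_powers_const)

lemma is_binomial_subst_powers: "is_binomial g \<Longrightarrow> is_binomial (subst_powers d g)"
  unfolding is_binomial_def by (force simp: ring_map_diff[OF ring_map_subst_powers] subst_powers_monom)

section \<open>Orders and character sums in the multiplicative group\<close>

lemma power_eq_power_iff_mod_mult_order:
  fixes x :: "'k::{field, finite}"
  assumes "x \<noteq> 0"
  shows "0 < mult_order x" "x ^ mult_order x = 1"
    "x ^ a = x ^ b \<longleftrightarrow> a mod mult_order x = b mod mult_order x"
proof -
  have cancel: "x ^ (j - i) = 1" if "x ^ i = x ^ j" "i \<le> j" for i j
    using that assms by (simp add: power_diff)
  \<comment> \<open>The field is finite, so the powers of x repeat; this makes the set in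
    \<open>LEAST\<close> nonempty.\<close>
  have "\<not> inj (\<lambda>k::nat. x ^ k)"
    using finite_imageD[of "\<lambda>k::nat. x ^ k" UNIV] by (meson finite infinite_UNIV_nat)
  then obtain i j :: nat where "x ^ i = x ^ j" "i \<noteq> j" by (auto simp: inj_def)
  then have "\<exists>k. 0 < k \<and> x ^ k = 1"
    using cancel[of i j] cancel[of j i] by (metis linorder_neq_iff less_imp_le zero_less_diff)
  then have m: "0 < mult_order x \<and> x ^ mult_order x = 1"
    unfolding mult_order_def by (rule LeastI_ex)
  then show "0 < mult_order x" "x ^ mult_order x = 1" by auto
  have red: "x ^ k = x ^ (k mod mult_order x)" for k
  proof -
    have "x ^ k = (x ^ mult_order x) ^ (k div mult_order x) * x ^ (k mod mult_order x)"
      by (simp flip: power_mult power_add)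
    then show ?thesis using m by simp
  qed
  have le: "i = j" if "x ^ i = x ^ j" "i \<le> j" "j < mult_order x" for i j
  proof (rule ccontr)
    assume "i \<noteq> j"
    then have "mult_order x \<le> j - i"
      unfolding mult_order_def using cancel[OF that(1,2)] that(2) by (intro Least_le) auto
    then show False using that m by linarith
  qed
  show "x ^ a = x ^ b \<longleftrightarrow> a mod mult_order x = b mod mult_order x"
    using red[of a] red[of b] le[of "a mod mult_order x" "b mod mult_order x"]
      le[of "b mod mult_order x" "a mod mult_order x"] m
    by (metis linorder_linear mod_less_divisor)
qed

lemma generates_units_nonzero: "generates_units \<beta> \<Longrightarrow> \<beta> \<noteq> 0"
  unfolding generates_units_def by (metis (mono_tags, lifting) mem_Collect_eq power_one_right)

text \<open>Adding 1 permutes the field, so the number of its elements is 0 in the field; leaving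
  out the element 0 gives - 1.\<close>

lemma sum_nonzero_one: "(\<Sum>x | x \<noteq> (0::'k::{field, finite}). 1 :: 'k) = - 1"
proof -
  have "(\<Sum>x\<in>UNIV. x) = (\<Sum>x\<in>UNIV. x + 1 :: 'k)"
    by (rule sum.reindex_bij_witness[of _ "\<lambda>x. x + 1" "\<lambda>x. x - 1"]) auto
  then have "(\<Sum>x\<in>(UNIV::'k set). 1 :: 'k) = 0" by (simp add: sum.distrib)
  moreover have "(UNIV::'k set) = insert 0 {x. x \<noteq> 0}" by auto
  ultimately have "(\<Sum>x\<in>insert 0 {x. x \<noteq> (0::'k)}. 1 :: 'k) = 0" by simp
  then show ?thesis by (simp add: add_eq_0_iff)
qed

text \<open>The summand is a character of the unit group, written as a ratio to allow a negative
  exponent. Replacing x by \<beta> * x multiplies the sum by the value of the character at \<beta>,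
  so the sum is 0 unless this value is 1; in that case the character is trivial because \<beta>
  generates.\<close>

lemma sum_nonzero_power_ratio:
  fixes \<beta> :: "'k::{field, finite}"
  assumes "generates_units \<beta>"
  shows "(\<Sum>x | x \<noteq> (0::'k). x ^ k / x ^ l) = (if \<beta> ^ k = \<beta> ^ l then - 1 else 0)"
proof -
  have \<beta>: "\<beta> \<noteq> 0" using assms by (rule generates_units_nonzero)
  let ?s = "\<Sum>x | x \<noteq> (0::'k). x ^ k / x ^ l"
  have "?s = (\<Sum>x | x \<noteq> (0::'k). (\<beta> * x) ^ k / (\<beta> * x) ^ l)"
    by (rule sum.reindex_bij_witness[of _ "\<lambda>x. \<beta> * x" "\<lambda>x. x / \<beta>"]) (use \<beta> in auto)
  also have "\<dots> = \<beta> ^ k / \<beta> ^ l * ?s"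
    by (simp add: sum_distrib_left power_mult_distrib)
  finally have "(\<beta> ^ k / \<beta> ^ l - 1) * ?s = 0" by (simp add: algebra_simps)
  then have "?s = 0" if "\<beta> ^ k \<noteq> \<beta> ^ l" using that \<beta> by simp
  moreover have "?s = - 1" if eq: "\<beta> ^ k = \<beta> ^ l"
  proof -
    have "x ^ k / x ^ l = 1" if "x \<noteq> 0" for x :: 'k
    proof -
      obtain m where "x = \<beta> ^ m"
        using assms \<open>x \<noteq> 0\<close> unfolding generates_units_def by blast
      then have "x ^ k = x ^ l" by (metis eq power_commutes power_mult mult.commute)
      then show ?thesis using \<open>x \<noteq> 0\<close> by simp
    qed
    then have "?s = (\<Sum>x | x \<noteq> (0::'k). 1)" by (intro sum.cong) auto
    then show ?thesis by (simp only: sum_nonzero_one)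
  qed
  ultimately show ?thesis by simp
qed

section \<open>The vanishing ideal of the torus\<close>

lemma prod_power_scale:
  fixes y :: "'n::finite \<Rightarrow> 'k::comm_ring_1"
  assumes "\<And>i. y i ^ d i = 1"
  shows "(\<Prod>i\<in>UNIV. y i ^ Poly_Mapping.lookup (scale_exponent d a) i) = 1"
  by (simp add: lookup_scale_exponent power_mult assms)

lemma mv_eval_homogeneous_scale:
  fixes f :: "('n::finite, 'k::field) mvpoly"
  assumes "homogeneous f"
  shows "\<exists>e. \<forall>c x. mv_eval (\<lambda>c. c) (\<lambda>i. c * x i) f = c ^ e * mv_eval (\<lambda>c. c) x f"
proof -
  obtain e where e: "\<And>a. a \<in> Poly_Mapping.keys f \<Longrightarrow> (\<Sum>i\<in>UNIV. Poly_Mapping.lookup a i) = e"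
    using assms unfolding homogeneous_def by blast
  have "mv_eval (\<lambda>c. c) (\<lambda>i. c * x i) f = c ^ e * mv_eval (\<lambda>c. c) x f" for c x
    unfolding mv_eval_def sum_distrib_left
  proof (rule sum.cong[OF refl])
    fix a assume "a \<in> Poly_Mapping.keys f"
    then have "(\<Prod>i\<in>UNIV. c ^ Poly_Mapping.lookup a i) = c ^ e"
      using e by (simp flip: power_sum)
    then show "Poly_Mapping.lookup f a * (\<Prod>i\<in>UNIV. (c * x i) ^ Poly_Mapping.lookup a i) =
        c ^ e * (Poly_Mapping.lookup f a * (\<Prod>i\<in>UNIV. x i ^ Poly_Mapping.lookup a i))"
      by (simp add: power_mult_distrib prod.distrib mult_ac)
  qed
  then show ?thesis by blast
qed

text \<open>By homogeneity, scaling a representative multiplies the value by a power of a unit, so a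
  single representative decides vanishing at a projective point.\<close>

lemma vanishes_on_degenerate_torus_iff:
  fixes f :: "('n::finite, 'k::field) mvpoly"
  assumes "homogeneous f"
  shows "(\<forall>Q\<in>degenerate_torus v. vanishes_at f Q) \<longleftrightarrow>
    (\<forall>x. (\<forall>i. x i \<noteq> 0) \<longrightarrow> mv_eval (\<lambda>c. c) (\<lambda>i. x i ^ v i) f = 0)"
proof -
  obtain e where e: "\<And>c x. mv_eval (\<lambda>c. c) (\<lambda>i. c * x i) f = c ^ e * mv_eval (\<lambda>c. c) x f"
    using mv_eval_homogeneous_scale[OF assms] by blast
  have "vanishes_at f (proj_point y) \<longleftrightarrow> mv_eval (\<lambda>c. c) y f = 0" for y
  proof -
    have "vanishes_at f (proj_point y) \<longleftrightarrow> (\<forall>c. c \<noteq> 0 \<longrightarrow> c ^ e * mv_eval (\<lambda>c. c) y f = 0)"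
      by (auto simp: vanishes_at_def proj_point_def e)
    then show ?thesis by (metis mult_eq_0_iff one_neq_zero power_one)
  qed
  then show ?thesis by (auto simp: degenerate_torus_def)
qed

text \<open>Orthogonality of the characters \<open>x \<mapsto> \<Prod>i. (x i ^ v i) ^ a i\<close> of the torus: the
  average of \<open>f\<close> against the inverse of the character of \<open>b\<close> isolates one class sum.\<close>

lemma class_sum_eq_0_if_vanishes:
  fixes f :: "('n::finite, 'k::{field, finite}) mvpoly" and \<beta> :: 'k
  assumes \<beta>: "generates_units \<beta>" and d: "\<And>i. d i = mult_order (\<beta> ^ v i)"
    and f: "\<And>x. (\<And>i. x i \<noteq> 0) \<Longrightarrow> mv_eval (\<lambda>c. c) (\<lambda>i. x i ^ v i) f = 0"
  shows "class_sum (\<lambda>a i. Poly_Mapping.lookup a i mod d i) f (\<lambda>i. Poly_Mapping.lookup b i mod d i) = 0"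
proof -
  let ?T = "PiE UNIV (\<lambda>_::'n. {x::'k. x \<noteq> 0})" and ?l = "Poly_Mapping.lookup"
  let ?chi = "\<lambda>a (x::'n \<Rightarrow> 'k). \<Prod>i\<in>UNIV. x i ^ (v i * ?l a i) / x i ^ (v i * ?l b i)"
  \<comment> \<open>The sum over the torus factors into one-variable character sums. Each factor is
    - 1 or 0, and it is nonzero exactly when the exponents agree modulo the order \<open>d i\<close>
    of \<beta> to the power \<open>v i\<close>.\<close>
  have orth: "(\<Sum>x\<in>?T. ?chi a x) =
      (if (\<lambda>i. ?l a i mod d i) = (\<lambda>i. ?l b i mod d i) then (- 1) ^ CARD('n) else 0)" for a
  proof -
    have iff: "\<beta> ^ (v i * ?l a i) = \<beta> ^ (v i * ?l b i) \<longleftrightarrow> ?l a i mod d i = ?l b i mod d i" for i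
      using power_eq_power_iff_mod_mult_order(3)[of "\<beta> ^ v i"] generates_units_nonzero[OF \<beta>]
      by (simp add: d power_mult)
    have "(\<Sum>x\<in>?T. ?chi a x) =
        (\<Prod>i\<in>UNIV. \<Sum>x | x \<noteq> (0::'k). x ^ (v i * ?l a i) / x ^ (v i * ?l b i))"
      by (rule prod_sum_PiE[symmetric]) auto
    also have "\<dots> = (\<Prod>i\<in>UNIV. if ?l a i mod d i = ?l b i mod d i then - 1 else 0)"
      by (simp only: sum_nonzero_power_ratio[OF \<beta>] iff)
    finally have *: "(\<Sum>x\<in>?T. ?chi a x) = \<dots>" .
    show ?thesis
    proof (cases "(\<lambda>i. ?l a i mod d i) = (\<lambda>i. ?l b i mod d i)")
      case True
      then have "?l a i mod d i = ?l b i mod d i" for i by (rule fun_cong)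
      with True * show ?thesis by simp
    next
      case False
      then obtain i where "?l a i mod d i \<noteq> ?l b i mod d i" by blast
      with False * show ?thesis by (auto intro!: prod_zero)
    qed
  qed
  have "0 = (\<Sum>x\<in>?T. mv_eval (\<lambda>c. c) (\<lambda>i. x i ^ v i) f / (\<Prod>i\<in>UNIV. x i ^ (v i * ?l b i)))"
    using f by (auto simp: PiE_iff)
  also have "\<dots> = (\<Sum>x\<in>?T. \<Sum>a\<in>Poly_Mapping.keys f. ?l f a * ?chi a x)"
    by (simp add: mv_eval_def sum_divide_distrib prod_dividef flip: power_mult)
  also have "\<dots> = (\<Sum>a\<in>Poly_Mapping.keys f. ?l f a * (\<Sum>x\<in>?T. ?chi a x))"
    by (subst sum.swap) (simp add: sum_distrib_left)
  also have "\<dots> = (\<Sum>a\<in>Poly_Mapping.keys f. (- 1) ^ CARD('n) *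
      (if (\<lambda>i. ?l a i mod d i) = (\<lambda>i. ?l b i mod d i) then ?l f a else 0))"
    by (rule sum.cong) (simp_all add: orth)
  also have "\<dots> = (- 1) ^ CARD('n) *
      class_sum (\<lambda>a i. ?l a i mod d i) f (\<lambda>i. ?l b i mod d i)"
    unfolding class_sum_def sum_distrib_left[symmetric]
    by (rule arg_cong[where f = "(*) _"]) (rule sum.mono_neutral_cong_right, auto)
  finally show ?thesis by simp
qed

text \<open>Take t^u to be the greatest common divisor of t^a and t^b. What remains is given by
  truncated differences, which are multiples of \<open>d i\<close> by congruence; cancelling u from
  the equal total degrees gives equal weights.\<close>

lemma exponents_congruent_decompose:
  fixes d :: "'n::finite \<Rightarrow> nat"
  assumes "weight (\<lambda>_. 1) a = weight (\<lambda>_. 1) b"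
    and "\<And>i. Poly_Mapping.lookup a i mod d i = Poly_Mapping.lookup b i mod d i"
  obtains u \<alpha> \<beta> where "a = u + scale_exponent d \<alpha>" "b = u + scale_exponent d \<beta>"
    "weight d \<alpha> = weight d \<beta>"
    "\<And>i. Poly_Mapping.lookup u i = min (Poly_Mapping.lookup a i) (Poly_Mapping.lookup b i)"
proof -
  let ?l = "Poly_Mapping.lookup"
  define u where "u = Abs_poly_mapping (\<lambda>i. min (?l a i) (?l b i))"
  define \<alpha> where "\<alpha> = Abs_poly_mapping (\<lambda>i. (?l a i - ?l b i) div d i)"
  define \<beta> where "\<beta> = Abs_poly_mapping (\<lambda>i. (?l b i - ?l a i) div d i)"
  have u: "?l u i = min (?l a i) (?l b i)" for i by (simp add: u_def)
  have dvd: "d i dvd ?l a i - ?l b i" "d i dvd ?l b i - ?l a i" for i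
    using assms(2)[of i] mod_eq_dvd_iff_nat[of "?l a i" "?l b i" "d i"]
      mod_eq_dvd_iff_nat[of "?l b i" "?l a i" "d i"] by (metis dvd_0_right diff_is_0_eq nat_le_linear)+
  have a: "a = u + scale_exponent d \<alpha>" and b: "b = u + scale_exponent d \<beta>"
    using dvd by (auto intro!: poly_mapping_eqI simp: lookup_add lookup_scale_exponent \<alpha>_def \<beta>_def u)
  have "weight (\<lambda>_. 1) (scale_exponent d \<alpha>) = weight (\<lambda>_. 1) (scale_exponent d \<beta>)"
    using assms(1) by (subst (asm) a, subst (asm) b) (simp add: weight_add)
  then show ?thesis using that[OF a b _ u] by (simp only: weight_scale_exponent)
qed

lemma homogeneous_scale_diff:
  assumes "weight d \<alpha> = weight d \<beta>"
  shows "homogeneous (mv_monom (scale_exponent d \<alpha>) - mv_monom (scale_exponent d \<beta>))"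
  unfolding homogeneous_def
proof (intro exI ballI)
  fix a :: "'a \<Rightarrow>\<^sub>0 nat"
  assume "a \<in> Poly_Mapping.keys
    (mv_monom (scale_exponent d \<alpha>) - mv_monom (scale_exponent d \<beta>) :: ('a, 'b) mvpoly)"
  then have "a = scale_exponent d \<alpha> \<or> a = scale_exponent d \<beta>"
    by (auto simp: in_keys_iff lookup_minus mv_monom_def lookup_single when_def split: if_splits)
  then show "(\<Sum>i\<in>UNIV. Poly_Mapping.lookup a i) = weight d \<alpha>"
    using assms weight_scale_exponent[of d \<alpha>] weight_scale_exponent[of d \<beta>]
    by (auto simp: weight_def)
qed

lemma ideal_gen_subst_powers_toric_ideal:
  fixes d :: "'n::finite \<Rightarrow> nat"
  shows "ideal_gen (subst_powers d ` toric_ideal d) =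
    (ideal_gen {mv_monom (scale_exponent d a) - mv_monom (scale_exponent d b) | a b.
      weight d a = weight d b} :: ('n, 'k::field) mvpoly set)"
proof -
  let ?B = "{mv_monom a - mv_monom b | a b. weight d a = weight d b} :: ('n, 'k) mvpoly set"
  have "ideal_gen (toric_ideal d) = ideal_gen ?B"
    using ideal_gen_ideal[OF is_ideal_toric_ideal] toric_ideal_eq_ideal_gen by (rule trans)
  then have "ideal_gen (subst_powers d ` toric_ideal d) = ideal_gen (subst_powers d ` ?B)"
    by (rule ideal_gen_image_cong[OF ring_map_subst_powers])
  also have "subst_powers d ` ?B =
      {subst_powers d (mv_monom a - mv_monom b) | a b. weight d a = weight d b}" by blast
  finally show ?thesis
    by (simp only: ring_map_diff[OF ring_map_subst_powers] subst_powers_monom)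
qed

text \<open>The character sums kill all class sums of a homogeneous vanishing polynomial, which
  places it in the binomial ideal. Conversely, each coordinate of a torus point has
  \<open>d i\<close>-th power 1, so both terms of a binomial in \<open>?B\<close> evaluate to
  1.\<close>

lemma vanishing_ideal_degenerate_torus:
  fixes \<beta> :: "'k::{field, finite}" and v d :: "'n::finite \<Rightarrow> nat"
  assumes \<beta>: "generates_units \<beta>" and d: "\<And>i. d i = mult_order (\<beta> ^ v i)"
  shows "(vanishing_ideal (degenerate_torus v) :: ('n, 'k) mvpoly set) =
    ideal_gen (subst_powers d ` toric_ideal d)"
proof -
  let ?B = "{mv_monom (scale_exponent d a) - mv_monom (scale_exponent d b) | a b.
    weight d a = weight d b} :: ('n, 'k) mvpoly set"
  let ?I = "ideal_gen ?B"
  let ?V = "{f :: ('n, 'k) mvpoly. homogeneous f \<and> (\<forall>Q\<in>degenerate_torus v. vanishes_at f Q)}"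
  have "?V \<subseteq> ?I"
  proof
    fix f assume f: "f \<in> ?V"
    let ?\<kappa> = "\<lambda>a i. Poly_Mapping.lookup a i mod d i"
    have "\<And>x. (\<And>i. x i \<noteq> 0) \<Longrightarrow> mv_eval (\<lambda>c. c) (\<lambda>i. x i ^ v i) f = 0"
      using f vanishes_on_degenerate_torus_iff[of f v] by auto
    then have sums: "class_sum ?\<kappa> f (?\<kappa> b) = 0" for b
      by (rule class_sum_eq_0_if_vanishes[OF \<beta> d])
    show "f \<in> ?I"
    proof (rule mem_ideal_if_class_sums_eq_0[OF is_ideal_ideal_gen, where \<kappa> = ?\<kappa>])
      fix w show "class_sum ?\<kappa> f w = 0"
      proof (cases "\<exists>b. w = ?\<kappa> b")
        case False
        then have "{a \<in> Poly_Mapping.keys f. ?\<kappa> a = w} = {}" by blast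
        then show ?thesis unfolding class_sum_def by (simp only: sum.empty)
      qed (use sums in auto)
    next
      fix a b assume ab: "a \<in> Poly_Mapping.keys f" "b \<in> Poly_Mapping.keys f" "?\<kappa> a = ?\<kappa> b"
      \<comment> \<open>The class map records residues only; equality of degrees comes from
        homogeneity of f.\<close>
      have "weight (\<lambda>_. 1) a = weight (\<lambda>_. 1) b"
        using f ab(1,2) by (auto simp: homogeneous_def weight_def)
      then obtain u \<alpha> \<gamma> where "a = u + scale_exponent d \<alpha>" "b = u + scale_exponent d \<gamma>"
        and w: "weight d \<alpha> = weight d \<gamma>"
        using exponents_congruent_decompose[of a b d] fun_cong[OF ab(3)] by metis
      then have "mv_monom a - mv_monom b =
          mv_monom u * (mv_monom (scale_exponent d \<alpha>) - mv_monom (scale_exponent d \<gamma>) ::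
            ('n, 'k) mvpoly)"
        by (simp add: mv_monom_add right_diff_distrib)
      also have "\<dots> \<in> ?I"
        using w by (intro ideal_mult[OF is_ideal_ideal_gen] ideal_gen_base) blast
      finally show "mv_monom a - mv_monom b \<in> ?I" .
    qed
  qed
  moreover have "?B \<subseteq> ideal_gen ?V"
  proof (intro subsetI ideal_gen_base)
    fix h assume "h \<in> ?B"
    then obtain a b where w: "weight d a = weight d b"
      and h: "h = mv_monom (scale_exponent d a) - mv_monom (scale_exponent d b)"
      by blast
    have hom: "homogeneous h" unfolding h by (rule homogeneous_scale_diff[OF w])
    moreover have "mv_eval (\<lambda>c. c) (\<lambda>i. x i ^ v i) h = 0" if x: "\<forall>i. x i \<noteq> 0" for x :: "'n \<Rightarrow> 'k"
    proof -
      have "(x i ^ v i) ^ d i = 1" for i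
      proof -
        obtain m where "x i = \<beta> ^ m"
          using x \<beta> unfolding generates_units_def by blast
        then have "(x i ^ v i) ^ d i = ((\<beta> ^ v i) ^ d i) ^ m"
          by (simp add: mult_ac flip: power_mult)
        then show ?thesis
          using power_eq_power_iff_mod_mult_order(2)[of "\<beta> ^ v i"] generates_units_nonzero[OF \<beta>]
          by (simp add: d)
      qed
      then show ?thesis
        by (simp add: h ring_map_diff[OF ring_map_mv_eval[OF ring_map_ident]]
            mv_eval_monom[OF ring_map_ident] prod_power_scale)
    qed
    ultimately show "h \<in> ?V" using vanishes_on_degenerate_torus_iff[OF hom] by blast
  qed
  ultimately have "ideal_gen ?V = ?I" by (rule ideal_gen_eqI)
  then show ?thesis by (simp only: vanishing_ideal_def ideal_gen_subst_powers_toric_ideal)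
qed

section \<open>Binomial generators\<close>

lemma inj_scale_exponent: "(\<And>i. 0 < d i) \<Longrightarrow> inj (scale_exponent d)"
  by (intro injI poly_mapping_eqI) (metis lookup_scale_exponent mult_cancel1 not_gr_zero)

text \<open>\<open>S\<close> is a free module over the subring of polynomials in the \<open>t i ^ d i\<close>, with the constant
  monomial in a basis; this is the projection onto that coordinate.\<close>

lift_definition descale :: "('n::finite \<Rightarrow> nat) \<Rightarrow> ('n, 'k::comm_ring_1) mvpoly \<Rightarrow> ('n, 'k) mvpoly"
  is "\<lambda>d f b. if \<forall>i. 0 < d i then f (scale_exponent d b) else 0"
proof -
  fix d :: "'n \<Rightarrow> nat" and f :: "('n \<Rightarrow>\<^sub>0 nat) \<Rightarrow> 'k"
  assume fin: "finite {a. f a \<noteq> 0}"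
  show "finite {b. (if \<forall>i. 0 < d i then f (scale_exponent d b) else 0) \<noteq> 0}"
  \<comment> \<open>The guard on d secures finite support: if some \<open>d i\<close> is 0, then
    scaling is not injective and a coefficient of f is repeated infinitely often.\<close>
  proof (cases "\<forall>i. 0 < d i")
    case True
    then have "inj (scale_exponent d)" by (simp add: inj_scale_exponent)
    then show ?thesis using finite_vimageI[OF fin] True by (simp add: vimage_def)
  qed simp
qed

lemma lookup_descale:
  "(\<And>i. 0 < d i) \<Longrightarrow>
    Poly_Mapping.lookup (descale d f) b = Poly_Mapping.lookup f (scale_exponent d b)"
  by (simp add: descale.rep_eq)

lemma scale_exponent_add: "scale_exponent d (a + b) = scale_exponent d a + scale_exponent d b"
  by (rule poly_mapping_eqI) (simp add: lookup_scale_exponent lookup_add distrib_left)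

lemma descale_add: "(\<And>i. 0 < d i) \<Longrightarrow> descale d (f + g) = descale d f + descale d g"
  by (rule poly_mapping_eqI) (simp add: lookup_descale lookup_add)

lemma descale_single_scale:
  assumes "\<And>i. 0 < d i"
  shows "descale d (Poly_Mapping.single (scale_exponent d a) c) = Poly_Mapping.single a c"
  by (rule poly_mapping_eqI)
    (auto simp: lookup_descale[OF assms] lookup_single when_def
      dest: injD[OF inj_scale_exponent[OF assms]])

lemma descale_single_not_scale:
  assumes "\<And>i. 0 < d i" "\<And>b. a \<noteq> scale_exponent d b"
  shows "descale d (Poly_Mapping.single a c) = 0"
  by (rule poly_mapping_eqI) (simp add: lookup_descale[OF assms(1)] lookup_single when_def assms(2))

text \<open>The projection is linear over the image of the substitution: adding a scaled exponent to
  a gives a scaled exponent only if a is scaled already. By additivity it suffices to treat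
  monomials.\<close>

lemma descale_mult_subst_powers:
  fixes q g :: "('n::finite, 'k::comm_ring_1) mvpoly"
  assumes d: "\<And>i. 0 < d i"
  shows "descale d (q * subst_powers d g) = descale d q * g"
proof (induction q rule: poly_mapping_add_induct)
  case (single a c)
  show ?case
  proof (induction g rule: poly_mapping_add_induct)
    case (single b e)
    show ?case
    proof (cases "\<exists>a'. a = scale_exponent d a'")
      case True
      then show ?thesis
        by (auto simp: subst_powers_single mult_single descale_single_scale[OF d]
            simp flip: scale_exponent_add)
    next
      case False
      have "a + scale_exponent d b \<noteq> scale_exponent d b'" for b'
      proof
        assume eq: "a + scale_exponent d b = scale_exponent d b'"
        have "Poly_Mapping.lookup a i = d i * (Poly_Mapping.lookup b' i - Poly_Mapping.lookup b i)" for i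
          using arg_cong[OF eq, of "\<lambda>a. Poly_Mapping.lookup a i"]
          by (simp add: lookup_add lookup_scale_exponent right_diff_distrib')
        then have "a = scale_exponent d (b' - b)"
          by (intro poly_mapping_eqI) (simp add: lookup_scale_exponent lookup_minus)
        with False show False by blast
      qed
      with False show ?thesis
        by (simp add: subst_powers_single mult_single descale_single_not_scale[OF d])
    qed
  qed (simp add: ring_map_add[OF ring_map_subst_powers] distrib_left descale_add[OF d])
qed (simp add: distrib_right descale_add[OF d])

text \<open>Applying the projection to a combination of the substituted generators turns their
  coefficients into coefficients for \<open>B\<close> itself, while the projection sends the image
  of f back to f.\<close>

lemma mem_ideal_gen_if_subst_powers_mem:
  fixes f :: "('n::finite, 'k::comm_ring_1) mvpoly"
  assumes d: "\<And>i. 0 < d i" and f: "subst_powers d f \<in> ideal_gen (subst_powers d ` B)"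
  shows "f \<in> ideal_gen B"
proof -
  note id = is_ideal_ideal_gen[of B]
  let ?J = "{x. \<forall>q. descale d (q * x) \<in> ideal_gen B}"
  have z: "descale d 0 = 0"
    by (rule poly_mapping_eqI) (simp add: lookup_descale[OF d])
  have "is_ideal ?J"
    by (auto simp: is_ideal_iff z ideal_zero[OF id] distrib_left descale_add[OF d]
        simp flip: mult.assoc intro: ideal_add[OF id])
  moreover have "subst_powers d ` B \<subseteq> ?J"
  proof (clarify)
    fix b q assume "b \<in> B"
    then show "descale d (q * subst_powers d b) \<in> ideal_gen B"
      unfolding descale_mult_subst_powers[OF d] by (rule ideal_mult[OF id ideal_gen_base])
  qed
  ultimately have "subst_powers d f \<in> ?J" using f ideal_gen_minimal by blast
  then have "descale d (1 * subst_powers d f) \<in> ideal_gen B" by blast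
  moreover have "descale d 1 = (1 :: ('n, 'k) mvpoly)"
    using descale_single_scale[of d 0 1, OF d] by (simp add: scale_exponent_def)
  ultimately show ?thesis by (simp only: descale_mult_subst_powers[OF d]) simp
qed

lemma ideal_gen_subst_powers_eq_iff:
  fixes A B :: "('n::finite, 'k::comm_ring_1) mvpoly set"
  assumes "\<And>i. 0 < d i"
  shows "ideal_gen (subst_powers d ` A) = ideal_gen (subst_powers d ` B) \<longleftrightarrow> ideal_gen A = ideal_gen B"
    (is "?l \<longleftrightarrow> ?r")
proof
  have sub: "A \<subseteq> ideal_gen B"
    if "ideal_gen (subst_powers d ` A) = ideal_gen (subst_powers d ` B)"
    for A B :: "('n, 'k) mvpoly set"
  proof
    fix f assume "f \<in> A"
    then have "subst_powers d f \<in> ideal_gen (subst_powers d ` B)"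
      unfolding that[symmetric] by (intro ideal_gen_base imageI)
    then show "f \<in> ideal_gen B" by (rule mem_ideal_gen_if_subst_powers_mem[OF assms])
  qed
  assume ?l
  then show ?r using sub[of A B] sub[of B A] by (intro ideal_gen_eqI) auto
qed (rule ideal_gen_image_cong[OF ring_map_subst_powers])

section \<open>Real spans of differences of exponent vectors\<close>

definition exponent_vector :: "('n::finite \<Rightarrow>\<^sub>0 nat) \<Rightarrow> real ^ 'n" where
  "exponent_vector a = (\<chi> i. real (Poly_Mapping.lookup a i))"

lemma exponent_vector_add: "exponent_vector (a + b) = exponent_vector a + exponent_vector b"
  by (simp add: exponent_vector_def vec_eq_iff lookup_add)

lemma exponent_vector_single: "exponent_vector (Poly_Mapping.single i m) = real m *\<^sub>R axis i 1"
  by (auto simp: exponent_vector_def vec_eq_iff lookup_single when_def axis_def)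

text \<open>An element of the quotient by L, kept as a set so that it can serve as the value of a
  class map.\<close>

definition coset_of :: "'a::ab_group_add set \<Rightarrow> 'a \<Rightarrow> 'a set" where
  "coset_of L x = {y. y - x \<in> L}"

lemma coset_of_eq_iff:
  fixes L :: "'a::real_vector set"
  assumes "subspace L"
  shows "coset_of L x = coset_of L y \<longleftrightarrow> x - y \<in> L"
proof
  have "x \<in> coset_of L x" using subspace_0[OF assms] by (simp add: coset_of_def)
  also assume "coset_of L x = coset_of L y"
  finally show "x - y \<in> L" by (simp add: coset_of_def)
next
  assume xy: "x - y \<in> L"
  have "z - x \<in> L \<longleftrightarrow> z - y \<in> L" for z
    using subspace_add[OF assms _ xy, of "z - x"] subspace_diff[OF assms _ xy, of "z - y"]
    by (simp add: algebra_simps) blast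
  then show "coset_of L x = coset_of L y" by (simp add: coset_of_def)
qed

text \<open>Adjoining one axis vector to the differences gives all axis vectors, hence a spanning
  set of the whole space.\<close>

lemma card_spanning_differences:
  fixes W :: "(real ^ 'n) set"
  assumes "finite W" and "\<And>k. axis k 1 - axis z 1 \<in> span W"
  shows "CARD('n) \<le> Suc (card W)"
proof -
  let ?W = "insert (axis z 1) W"
  have ax: "axis k 1 \<in> span ?W" for k
  proof -
    have "axis k 1 - axis z 1 \<in> span ?W"
      using subsetD[OF span_mono[OF subset_insertI] assms(2)] .
    moreover have "axis z 1 \<in> span ?W" by (simp add: span_base)
    ultimately have "axis k 1 - axis z 1 + axis z 1 \<in> span ?W" by (rule span_add)
    then show ?thesis by simp
  qed
  have "x \<in> span ?W" for x :: "real ^ 'n"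
  proof -
    have "(\<Sum>k\<in>UNIV. (x $ k) *\<^sub>R axis k 1) \<in> span ?W"
      by (intro span_sum span_scale ax)
    then show ?thesis
      unfolding basis_expansion[of x, unfolded scalar_mult_eq_scaleR] .
  qed
  then have "dim (UNIV :: (real ^ 'n) set) \<le> card ?W"
    by (intro dim_le_card subsetI) (simp_all add: assms(1))
  also have "\<dots> \<le> Suc (card W)" by (simp add: assms(1) card_insert_if)
  finally show ?thesis by simp
qed

text \<open>If the two monomials of the generator \<open>h i\<close> had a common factor, removing it would leave a
  binomial of the ideal of smaller degree. In that degree \<open>h i\<close> does not contribute, so the
  exponent vector of \<open>h i\<close> is a combination of those of the other generators. Then \<open>CARD('n) - 2\<close>
  vectors span a space of dimension \<open>CARD('n) - 1\<close>.\<close>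

lemma binomial_generator_is_subst_powers:
  fixes h :: "nat \<Rightarrow> ('n::finite, 'k::field) mvpoly" and d :: "'n \<Rightarrow> nat"
  assumes d: "\<And>i. 0 < d i"
    and bin: "\<And>i. i \<in> {1..CARD('n) - 1} \<Longrightarrow> is_binomial (h i)"
    and gen: "ideal_gen (subst_powers d ` toric_ideal d) = ideal_gen (h ` {1..CARD('n) - 1})"
    and i: "i \<in> {1..CARD('n) - 1}"
  shows "\<exists>g. is_binomial g \<and> h i = subst_powers d g"
proof -
  let ?N = "{1..CARD('n) - 1}"
  let ?deg = "weight (\<lambda>_::'n. 1)"
  let ?I = "ideal_gen (h ` ?N)"
  have "\<forall>j\<in>?N. \<exists>a b. h j = mv_monom a - mv_monom b"
    using bin by (simp add: is_binomial_def)
  then obtain a b where h: "\<And>j. j \<in> ?N \<Longrightarrow> h j = mv_monom (a j) - mv_monom (b j)"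
    by metis
  let ?B = "{mv_monom (scale_exponent d a) - mv_monom (scale_exponent d b) | a b.
    weight d a = weight d b} :: ('n, 'k) mvpoly set"
  have gen': "ideal_gen ?B = ?I"
    by (simp only: gen flip: ideal_gen_subst_powers_toric_ideal)
  have memI: "mv_monom (scale_exponent d \<alpha>) - mv_monom (scale_exponent d \<gamma>) \<in> ?I"
    if "weight d \<alpha> = weight d \<gamma>" for \<alpha> \<gamma>
    unfolding gen'[symmetric] using that by (intro ideal_gen_base) blast
  have ab: "?deg (a j) = ?deg (b j) \<and>
      (\<forall>i. Poly_Mapping.lookup (a j) i mod d i = Poly_Mapping.lookup (b j) i mod d i)" if "j \<in> ?N" for j
  proof -
    \<comment> \<open>Total degree together with the residues modulo d is an invariant of the
      generators in \<open>?B\<close>, so the two terms of every h j agree in both.\<close>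
    let ?\<kappa> = "\<lambda>a. (?deg a, \<lambda>i. Poly_Mapping.lookup a i mod d i)"
    have "mv_monom (a j) - mv_monom (b j) \<in> ideal_gen ?B"
      unfolding gen' using that by (intro ideal_gen_base) (simp flip: h)
    then have "?\<kappa> (a j) = ?\<kappa> (b j)"
    proof (rule monom_diff_mem_ideal_gen_imp_eq)
      fix f assume "f \<in> ?B"
      then obtain \<alpha> \<gamma> where w: "weight d \<alpha> = weight d \<gamma>"
        and f: "f = mv_monom (scale_exponent d \<alpha>) - mv_monom (scale_exponent d \<gamma>)"
        by blast
      have "?\<kappa> (u + scale_exponent d \<alpha>) = ?\<kappa> (u + scale_exponent d \<gamma>)" for u
        by (simp only: weight_add weight_scale_exponent w) (simp add: lookup_add lookup_scale_exponent)
      with f show "\<exists>a b. f = mv_monom a - mv_monom b \<and> (\<forall>u. ?\<kappa> (u + a) = ?\<kappa> (u + b))" by blast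
    qed
    then show ?thesis by (auto dest: fun_cong)
  qed
  obtain u \<alpha> \<gamma> where ai: "a i = u + scale_exponent d \<alpha>" and bi: "b i = u + scale_exponent d \<gamma>"
    and w: "weight d \<alpha> = weight d \<gamma>"
    using exponents_congruent_decompose[of "a i" "b i" d] ab[OF i] by metis
  have "u = 0"
  proof (rule ccontr)
    assume "u \<noteq> 0"
    then obtain k where "Poly_Mapping.lookup u k \<noteq> 0" by (metis poly_mapping_eqI lookup_zero)
    then have u: "0 < ?deg u" unfolding weight_def by (intro sum_pos2[where i = k]) auto
    let ?V = "\<lambda>j. exponent_vector (a j) - exponent_vector (b j)"
    let ?L = "span (?V ` (?N - {i}))"
    note coset = coset_of_eq_iff[OF subspace_span]
    have "?V i \<in> ?L"
    proof -
      \<comment> \<open>The option type isolates one degree: monomials of any other degree share the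
        class \<open>None\<close>. Since u has positive degree, every multiple of a term of h i has
        larger degree, so only the other generators have to respect the cosets.\<close>
      let ?\<kappa> = "\<lambda>m. if ?deg m = weight d \<alpha> then Some (coset_of ?L (exponent_vector m)) else None"
      have "?\<kappa> (scale_exponent d \<alpha>) = ?\<kappa> (scale_exponent d \<gamma>)"
        using memI[OF w]
      proof (rule monom_diff_mem_ideal_gen_imp_eq)
        fix f assume "f \<in> h ` ?N"
        then obtain j where j: "j \<in> ?N" "f = h j" by blast
        have "?\<kappa> (m + a j) = ?\<kappa> (m + b j)" for m
        proof (cases "j = i")
          case True
          have "?deg (a i) > weight d \<alpha>" "?deg (b i) > weight d \<alpha>"
            using u w by (simp_all only: ai bi weight_add weight_scale_exponent)
          then show ?thesis using True by (simp add: weight_add)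
        next
          case False
          then have "?V j \<in> ?L" using j by (intro span_base) blast
          then show ?thesis using ab[OF j(1)]
            by (simp add: weight_add coset exponent_vector_add)
        qed
        then show "\<exists>a b. f = mv_monom a - mv_monom b \<and> (\<forall>u. ?\<kappa> (u + a) = ?\<kappa> (u + b))"
          using h[OF j(1)] j(2) by blast
      qed
      then have "exponent_vector (scale_exponent d \<alpha>) - exponent_vector (scale_exponent d \<gamma>) \<in> ?L"
        using w by (simp only: weight_scale_exponent if_True simp_thms option.inject coset)
      then show ?thesis by (simp add: ai bi exponent_vector_add)
    qed
    then have V: "?V j \<in> ?L" if "j \<in> ?N" for j
      using that by (cases "j = i") (auto intro: span_base)
    have "axis k 1 - axis k' 1 \<in> ?L" for k k' :: 'n
    proof -
      \<comment> \<open>Both exponents have weight \<open>d k * d k'\<close>, so the binomial lies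
        in P. After substitution its exponent vectors differ by this number times the difference of
        two axis vectors.\<close>
      let ?x = "Poly_Mapping.single k (d k')" and ?y = "Poly_Mapping.single k' (d k)"
      let ?\<kappa> = "\<lambda>m. coset_of ?L (exponent_vector m)"
      have "weight d ?x = weight d ?y" by (simp add: weight_single)
      from memI[OF this] have "?\<kappa> (scale_exponent d ?x) = ?\<kappa> (scale_exponent d ?y)"
      proof (rule monom_diff_mem_ideal_gen_imp_eq)
        fix f assume "f \<in> h ` ?N"
        then obtain j where j: "j \<in> ?N" "f = h j" by blast
        then have "\<forall>u. ?\<kappa> (u + a j) = ?\<kappa> (u + b j)"
          using V by (simp add: coset exponent_vector_add)
        then show "\<exists>a b. f = mv_monom a - mv_monom b \<and> (\<forall>u. ?\<kappa> (u + a) = ?\<kappa> (u + b))"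
          using h[OF j(1)] j(2) by blast
      qed
      moreover have "scale_exponent d (Poly_Mapping.single l m) = Poly_Mapping.single l (d l * m)" for l m
        by (rule poly_mapping_eqI) (auto simp: lookup_scale_exponent lookup_single when_def)
      ultimately have "real (d k * d k') *\<^sub>R (axis k 1 - axis k' 1) \<in> ?L"
        by (simp add: coset exponent_vector_single mult.commute scaleR_diff_right)
      from span_scale[OF this, of "1 / real (d k * d k')"]
      show ?thesis using d by (simp add: less_imp_neq[symmetric])
    qed
    then have "CARD('n) \<le> Suc (card (?V ` (?N - {i})))"
      by (intro card_spanning_differences) auto
    also have "card (?V ` (?N - {i})) \<le> card (?N - {i})" by (rule card_image_le) simp
    also have "card (?N - {i}) = CARD('n) - 1 - 1" using i by (subst card_Diff_singleton) auto
    \<comment> \<open>The existence of the index i forces at least two variables, so the truncated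
      subtraction is a genuine one and the bound is too small by 1.\<close>
    finally show False using i by auto
  qed
  then have "h i = subst_powers d (mv_monom \<alpha> - mv_monom \<gamma>)"
    using h[OF i] ai bi by (simp add: ring_map_diff[OF ring_map_subst_powers] subst_powers_monom)
  then show ?thesis unfolding is_binomial_def by blast
qed

section \<open>Height bounds\<close>

text \<open>Renaming the variables injectively to natural numbers embeds the ring into one whose
  exponent vectors are linearly ordered compatibly with addition; such a ring has no zero
  divisors.\<close>

lemma mvpoly_no_zero_divisors:
  fixes f g :: "('n::finite, 'k::field) mvpoly"
  assumes "f * g = 0"
  shows "f = 0 \<or> g = 0"
proof -
  obtain idx :: "'n \<Rightarrow> nat" where idx: "inj idx"
    using finite_imp_inj_to_nat_seg[OF finite[of "UNIV :: 'n set"]] by blast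
  define \<phi> where "\<phi> = mv_eval (mv_const :: 'k \<Rightarrow> (nat, 'k) mvpoly) (\<lambda>i. mv_var (idx i))"
  have \<phi>: "ring_map \<phi>" unfolding \<phi>_def by (rule ring_map_mv_eval[OF ring_map_mv_const])
  define \<kappa> where
    "\<kappa> a = (\<Sum>i\<in>UNIV. Poly_Mapping.single (idx i) (Poly_Mapping.lookup a i))" for a :: "'n \<Rightarrow>\<^sub>0 nat"
  have "Poly_Mapping.lookup (\<kappa> a) (idx i) = Poly_Mapping.lookup a i" for a i
    by (simp add: \<kappa>_def lookup_sum lookup_single when_def inj_eq[OF idx])
  then have \<kappa>: "inj \<kappa>" by (metis injI poly_mapping_eqI)
  \<comment> \<open>The renaming is the pushforward along \<kappa>; as \<kappa> is injective, it
    loses no coefficient.\<close>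
  have "Poly_Mapping.lookup (\<phi> h) w = class_sum \<kappa> h w" for h w
  proof (induction h rule: poly_mapping_add_induct)
    case (single a c)
    have "\<phi> (Poly_Mapping.single a c) = Poly_Mapping.single (\<kappa> a) c"
      unfolding \<phi>_def \<kappa>_def
      by (simp add: mv_eval_single[OF ring_map_mv_const] mv_var_power prod_mv_monom
          mv_const_mult_monom)
    then show ?case by (simp add: class_sum_single lookup_single when_def)
  qed (simp add: ring_map_add[OF \<phi>] lookup_add class_sum_add)
  moreover have "class_sum \<kappa> h (\<kappa> a) = Poly_Mapping.lookup h a" for h :: "('n, 'k) mvpoly" and a
    by (induction h rule: poly_mapping_add_induct)
      (simp_all add: class_sum_single lookup_single when_def inj_eq[OF \<kappa>] class_sum_add lookup_add)
  ultimately have inj: "h = 0" if "\<phi> h = 0" for h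
    using that by (metis lookup_zero poly_mapping_eqI)
  have "\<phi> f * \<phi> g = 0" by (simp add: assms ring_map_zero[OF \<phi>] flip: ring_map_mult[OF \<phi>])
  then show ?thesis using inj by auto
qed

lemma ring_map_mv_mv_eval: "ring_map (mv_eval mv_const x)"
  by (rule ring_map_mv_eval[OF ring_map_mv_const])

text \<open>Replacing the top member of a chain by a larger prime leaves the chain strictly
  increasing.\<close>

lemma prime_height_mono:
  assumes "is_prime_ideal p'" "p \<subseteq> p'"
  shows "prime_height p \<le> prime_height p'"
  unfolding prime_height_def
proof (rule SUP_least)
  fix k assume "k \<in> {k. \<exists>c. is_prime_chain c k \<and> c k = p}"
  then obtain c where c: "is_prime_chain c k" "c k = p" by blast
  have "is_prime_chain (c(k := p')) k"
    using c assms unfolding is_prime_chain_def by (auto simp: less_Suc_eq_le)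
  then have "k \<in> {k. \<exists>c. is_prime_chain c k \<and> c k = p'}" by (auto intro: exI[of _ "c(k := p')"])
  then show "enat k \<le> (SUP k\<in>{k. \<exists>c. is_prime_chain c k \<and> c k = p'}. enat k)"
    by (rule SUP_upper)
qed

section \<open>Counting residue classes of polynomials with bounded exponents\<close>

definition exponent_box :: "nat \<Rightarrow> ('n \<Rightarrow>\<^sub>0 nat) set" where
  "exponent_box s = {a. \<forall>i. Poly_Mapping.lookup a i \<le> s}"

definition poly_box :: "nat \<Rightarrow> ('n, 'k::comm_ring_1) mvpoly set" where
  "poly_box s = {f. Poly_Mapping.keys f \<subseteq> exponent_box s}"

lemma exponent_box_mono: "s \<le> t \<Longrightarrow> exponent_box s \<subseteq> exponent_box t"
  by (auto simp: exponent_box_def intro: order_trans)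

lemma poly_box_mono: "s \<le> t \<Longrightarrow> poly_box s \<subseteq> poly_box t"
  using exponent_box_mono by (auto simp: poly_box_def)

lemma poly_box_add: "f \<in> poly_box s \<Longrightarrow> g \<in> poly_box s \<Longrightarrow> f + g \<in> poly_box s"
  using keys_add[of f g] by (auto simp: poly_box_def)

lemma poly_box_mult: "f \<in> poly_box s \<Longrightarrow> g \<in> poly_box t \<Longrightarrow> f * g \<in> poly_box (s + t)"
  using keys_mult[of f g]
  by (fastforce simp: poly_box_def exponent_box_def lookup_add intro: add_mono)

lemma mem_poly_box: "\<exists>s. (f :: ('n::finite, 'k::comm_ring_1) mvpoly) \<in> poly_box s"
proof -
  let ?s = "\<Sum>a\<in>Poly_Mapping.keys f. weight (\<lambda>_. 1) a"
  have "Poly_Mapping.lookup a i \<le> ?s" if "a \<in> Poly_Mapping.keys f" for a i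
  proof -
    have "Poly_Mapping.lookup a i \<le> weight (\<lambda>_. 1) a"
      using member_le_sum[of i UNIV "Poly_Mapping.lookup a"] by (simp add: weight_def)
    also have "\<dots> \<le> ?s" using that by (intro member_le_sum) auto
    finally show ?thesis .
  qed
  then show ?thesis by (auto simp: poly_box_def exponent_box_def)
qed

lemma card_exponent_box:
  "finite (exponent_box s :: ('n::finite \<Rightarrow>\<^sub>0 nat) set)"
  "card (exponent_box s :: ('n \<Rightarrow>\<^sub>0 nat) set) \<le> Suc s ^ CARD('n)"
proof -
  let ?T = "PiE (UNIV :: 'n set) (\<lambda>_. {..s})"
  have "Poly_Mapping.lookup ` exponent_box s \<subseteq> ?T"
    by (auto simp: exponent_box_def)
  moreover have inj: "inj_on Poly_Mapping.lookup (exponent_box s :: ('n \<Rightarrow>\<^sub>0 nat) set)"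
    by (simp add: inj_on_def)
  moreover have fin: "finite ?T" by (intro finite_PiE) auto
  ultimately show "finite (exponent_box s :: ('n \<Rightarrow>\<^sub>0 nat) set)"
    "card (exponent_box s :: ('n \<Rightarrow>\<^sub>0 nat) set) \<le> Suc s ^ CARD('n)"
    using inj_on_finite[OF inj _ fin] card_inj_on_le[OF inj _ fin] by (simp_all add: card_PiE)
qed

lemma card_poly_box:
  "finite (poly_box s :: ('n::finite, 'k::{field, finite}) mvpoly set)"
  "card (poly_box s :: ('n, 'k) mvpoly set) \<le> CARD('k) ^ (Suc s ^ CARD('n))"
proof -
  let ?E = "exponent_box s :: ('n \<Rightarrow>\<^sub>0 nat) set"
  let ?r = "\<lambda>f :: ('n, 'k) mvpoly. restrict (Poly_Mapping.lookup f) ?E"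
  let ?T = "PiE ?E (\<lambda>_. UNIV :: 'k set)"
  have sub: "?r ` poly_box s \<subseteq> ?T" by auto
  have inj: "inj_on ?r (poly_box s)"
  proof (rule inj_onI)
    fix f g assume f: "f \<in> poly_box s" and g: "g \<in> poly_box s" and eq: "?r f = ?r g"
    show "f = g"
    proof (rule poly_mapping_eqI)
      fix a
      show "Poly_Mapping.lookup f a = Poly_Mapping.lookup g a"
      proof (cases "a \<in> ?E")
        case True
        then show ?thesis using fun_cong[OF eq, of a] by simp
      next
        case False
        then have "a \<notin> Poly_Mapping.keys f" "a \<notin> Poly_Mapping.keys g"
          using f g by (auto simp: poly_box_def)
        then show ?thesis by (simp add: in_keys_iff)
      qed
    qed
  qed
  have fin: "finite ?T" by (intro finite_PiE card_exponent_box) auto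
  show "finite (poly_box s :: ('n, 'k) mvpoly set)" by (rule inj_on_finite[OF inj sub fin])
  have "card (poly_box s :: ('n, 'k) mvpoly set) \<le> card ?T" by (rule card_inj_on_le[OF inj sub fin])
  also have "\<dots> = CARD('k) ^ card ?E" by (simp add: card_PiE card_exponent_box)
  also have "\<dots> \<le> CARD('k) ^ (Suc s ^ CARD('n))"
    by (intro power_increasing card_exponent_box) (simp add: Suc_le_eq)
  finally show "card (poly_box s :: ('n, 'k) mvpoly set) \<le> CARD('k) ^ (Suc s ^ CARD('n))" .
qed

text \<open>A discrete substitute for the Hilbert function of \<open>S/p\<close>: as \<open>K\<close> is finite, the dimension of
  the image of a box in \<open>S/p\<close> can be measured by counting.\<close>

definition many_classes :: "('n::finite, 'k::comm_ring_1) mvpoly set \<Rightarrow> nat \<Rightarrow> nat \<Rightarrow> bool" where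
  "many_classes p s H \<longleftrightarrow> (\<exists>A\<subseteq>poly_box s. finite A \<and> 2 ^ H \<le> card A \<and>
     (\<forall>x\<in>A. \<forall>y\<in>A. x - y \<in> p \<longrightarrow> x = y))"

lemma many_classes_mono: "many_classes p s H \<Longrightarrow> s \<le> t \<Longrightarrow> many_classes p t H"
  unfolding many_classes_def using order_trans[OF _ poly_box_mono[of s t]] by meson

lemma many_classes_0: "many_classes p s 0"
  unfolding many_classes_def
  by (rule exI[of _ "{0}"]) (auto simp: poly_box_def)

text \<open>A proper ideal separates 0 from 1, which gives two classes; this is the start of the
  induction along a chain of primes.\<close>

lemma many_classes_1:
  assumes "is_prime_ideal p"
  shows "many_classes p s 1"
proof -
  have id: "is_ideal p" using assms by (simp add: is_prime_ideal_def)
  have one: "1 \<notin> p"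
  proof
    assume "1 \<in> p"
    then have "x \<in> p" for x using ideal_mult[OF id, of 1 x] by simp
    then show False using assms by (auto simp: is_prime_ideal_def)
  qed
  moreover have "- 1 \<notin> p" using ideal_uminus[OF id, of "- 1"] one by auto
  ultimately show ?thesis unfolding many_classes_def
    by (intro exI[of _ "{0, 1}"]) (auto simp: poly_box_def exponent_box_def)
qed

lemma many_classes_bound:
  fixes p :: "('n::finite, 'k::{field, finite}) mvpoly set"
  assumes "many_classes p s H"
  shows "H \<le> CARD('k) * Suc s ^ CARD('n)"
proof -
  obtain A :: "('n, 'k) mvpoly set" where A: "A \<subseteq> poly_box s" "2 ^ H \<le> card A"
    using assms unfolding many_classes_def by blast
  have "(2::nat) ^ H \<le> card A" by (rule A)
  also have "\<dots> \<le> CARD('k) ^ (Suc s ^ CARD('n))"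
    using card_mono[OF card_poly_box(1) A(1)] card_poly_box(2) by (rule order_trans)
  \<comment> \<open>A crude bound on the field size by a power of 2, which allows exponents to base
    2 to be compared.\<close>
  also have "\<dots> \<le> (2 ^ CARD('k)) ^ (Suc s ^ CARD('n))"
    by (intro power_mono) (auto intro: less_imp_le less_exp)
  finally show ?thesis by (simp flip: power_mult)
qed

text \<open>With \<open>f \<in> q - p\<close>, the map \<open>(r, u) \<mapsto> r + f * u\<close> sends pairs of incongruent elements modulo
  \<open>q\<close> and modulo \<open>p\<close> to incongruent elements modulo \<open>p\<close>.\<close>

lemma many_classes_step:
  assumes p: "is_prime_ideal p" and q: "is_ideal q" "p \<subseteq> q"
    and f: "f \<in> q" "f \<notin> p" "f \<in> poly_box e"
    and M: "many_classes q (s + e) M" and N: "many_classes p s N"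
  shows "many_classes p (s + e) (M + N)"
proof -
  obtain R where R: "R \<subseteq> poly_box (s + e)" "finite R" "2 ^ M \<le> card R"
    and Rq: "\<And>x y. x \<in> R \<Longrightarrow> y \<in> R \<Longrightarrow> x - y \<in> q \<Longrightarrow> x = y"
    using M unfolding many_classes_def by blast
  obtain U where U: "U \<subseteq> poly_box s" "finite U" "2 ^ N \<le> card U"
    and Up: "\<And>x y. x \<in> U \<Longrightarrow> y \<in> U \<Longrightarrow> x - y \<in> p \<Longrightarrow> x = y"
    using N unfolding many_classes_def by blast
  have id: "is_ideal p" using p by (simp add: is_prime_ideal_def)
  let ?g = "\<lambda>(r, u). r + f * u"
  have inc: "r = r' \<and> u = u'"
    if "r \<in> R" "r' \<in> R" "u \<in> U" "u' \<in> U" and diff: "(r + f * u) - (r' + f * u') \<in> p" for r r' u u'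
  proof -
    have eq: "(r + f * u) - (r' + f * u') = (r - r') + f * (u - u')" by (simp add: algebra_simps)
    have "(r - r') + f * (u - u') \<in> q" using diff q(2) unfolding eq by blast
    from ideal_diff[OF q(1) this ideal_mult_right[OF q(1) f(1), of "u - u'"]]
    have "r = r'" using Rq that by simp
    moreover have "f * (u - u') \<in> p" using diff[unfolded eq] by (simp only: \<open>r = r'\<close> diff_self add_0_left)
    then have "u - u' \<in> p" using p f(2) unfolding is_prime_ideal_def by blast
    ultimately show ?thesis using Up that by blast
  qed
  have zero: "0 \<in> p" by (rule ideal_zero[OF id])
  have "inj_on ?g (R \<times> U)"
  proof (rule inj_onI, clarify)
    fix r u r' u' assume "r \<in> R" "u \<in> U" "r' \<in> R" "u' \<in> U" "r + f * u = r' + f * u'"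
    then show "r = r' \<and> u = u'" using inc zero by simp
  qed
  then have "card (?g ` (R \<times> U)) = card R * card U"
    by (simp add: card_image card_cartesian_product)
  then have "2 ^ (M + N) \<le> card (?g ` (R \<times> U))"
    using R(3) U(3) by (simp add: power_add mult_le_mono)
  moreover have "?g ` (R \<times> U) \<subseteq> poly_box (s + e)"
  proof clarify
    fix r u assume "r \<in> R" "u \<in> U"
    then have "f * u \<in> poly_box (s + e)"
      using poly_box_mult[OF f(3), of u s] U(1) by (auto simp: add.commute)
    then show "r + f * u \<in> poly_box (s + e)"
      using \<open>r \<in> R\<close> R(1) by (intro poly_box_add) auto
  qed
  moreover have "\<forall>x\<in>?g ` (R \<times> U). \<forall>y\<in>?g ` (R \<times> U). x - y \<in> p \<longrightarrow> x = y"
  proof clarify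
    fix r u r' u'
    assume "r \<in> R" "u \<in> U" "r' \<in> R" "u' \<in> U" "(r + f * u) - (r' + f * u') \<in> p"
    then show "r + f * u = r' + f * u'" using inc by blast
  qed
  ultimately show ?thesis
    unfolding many_classes_def using R(2) U(2)
    by (intro exI[of _ "?g ` (R \<times> U)"] conjI finite_imageI finite_SigmaI)
qed

text \<open>Passing to a smaller prime raises the growth exponent by one: each of m steps enlarges
  the box by a fixed amount and contributes m^k classes modulo q.\<close>

lemma many_classes_growth:
  assumes p: "is_prime_ideal p" and q: "is_prime_ideal q" "p \<subset> q"
    and c: "0 < c" "\<And>m. many_classes q (c * m) (m ^ k)"
  shows "\<exists>c'>0. \<forall>m. many_classes p (c' * m) (m ^ Suc k)"
proof -
  have id: "is_ideal q" using q by (simp add: is_prime_ideal_def)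
  obtain f where f: "f \<in> q" "f \<notin> p" using q(2) by blast
  obtain e where e: "f \<in> poly_box e" using mem_poly_box by blast
  \<comment> \<open>One constant for two purposes: it is at least c, so that the bound for q
    applies, and at least e, so that its box contains f.\<close>
  let ?C = "c * Suc e"
  have "e \<le> ?C" using c(1) by (cases c) auto
  then have fC: "f \<in> poly_box ?C" using e poly_box_mono by blast
  have "many_classes p (?C * (m + j)) (j * m ^ k)" for m j
  proof (induction j)
    case (Suc j)
    have "c * m \<le> ?C * (m + j) + ?C" by (simp add: algebra_simps)
    then have "many_classes q (?C * (m + j) + ?C) (m ^ k)" using c(2) many_classes_mono by blast
    from many_classes_step[OF p id _ f fC this Suc] q(2)
    show ?case by (simp add: algebra_simps psubset_imp_subset)
  qed (simp add: many_classes_0)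
  then have "many_classes p (?C * (m + m)) (m * m ^ k)" for m .
  moreover have "?C * (m + m) = 2 * ?C * m" "m * m ^ k = m ^ Suc k" for m
    by (simp_all add: algebra_simps)
  ultimately have "many_classes p (2 * ?C * m) (m ^ Suc k)" for m by (simp only:)
  moreover have "0 < 2 * ?C" using c(1) by simp
  ultimately show ?thesis by blast
qed

text \<open>Downward induction from the top of the chain; each prime passed adds one to the growth
  exponent.\<close>

lemma prime_chain_many_classes:
  assumes "is_prime_chain ch k" "j \<le> k"
  shows "\<exists>c>0. \<forall>m. many_classes (ch (k - j)) (c * m) (m ^ j)"
  using assms(2)
proof (induction j)
  case 0
  then show ?case using many_classes_1 assms(1) by (auto simp: is_prime_chain_def)
next
  case (Suc j)
  then obtain c where c: "0 < c" "\<And>m. many_classes (ch (k - j)) (c * m) (m ^ j)" by auto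
  have "k - j = Suc (k - Suc j)" using Suc.prems by simp
  then have "ch (k - Suc j) \<subset> ch (k - j)" "is_prime_ideal (ch (k - Suc j))" "is_prime_ideal (ch (k - j))"
    using assms(1) Suc.prems by (auto simp: is_prime_chain_def)
  then show ?case using many_classes_growth c by blast
qed

text \<open>A chain of length k forces m^k as exponent in boxes of size linear in m, whereas the
  size of the box allows only a constant multiple of m to the power \<open>CARD('n)\<close>.\<close>

lemma prime_chain_length_le:
  fixes ch :: "nat \<Rightarrow> ('n::finite, 'k::{field, finite}) mvpoly set"
  assumes "is_prime_chain ch k"
  shows "k \<le> CARD('n)"
proof (rule ccontr)
  let ?n = "CARD('n)"
  assume "\<not> k \<le> ?n"
  obtain c where "\<And>m. many_classes (ch 0) (c * m) (m ^ k)"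
    using prime_chain_many_classes[OF assms order_refl] by auto
  then have bound: "m ^ k \<le> CARD('k) * Suc (c * m) ^ ?n" for m by (rule many_classes_bound)
  \<comment> \<open>One more than the constant that compares the two growth rates.\<close>
  define m where "m = CARD('k) * Suc c ^ ?n + 1"
  have "m * m ^ ?n = m ^ Suc ?n" by simp
  also have "\<dots> \<le> m ^ k" using \<open>\<not> k \<le> ?n\<close> by (intro power_increasing) (auto simp: m_def)
  also have "\<dots> \<le> CARD('k) * Suc (c * m) ^ ?n" by (rule bound)
  also have "\<dots> \<le> CARD('k) * (Suc c * m) ^ ?n"
    by (intro mult_le_mono2 power_mono) (auto simp: m_def)
  also have "\<dots> = CARD('k) * Suc c ^ ?n * m ^ ?n" by (simp only: power_mult_distrib mult.assoc)
  also have "CARD('k) * Suc c ^ ?n = m - 1" by (simp add: m_def)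
  finally have "m \<le> m - 1" by (simp add: m_def)
  then show False by (simp add: m_def)
qed

text \<open>Appending q to a chain that ends in p lengthens it by one, and the longer chain still
  obeys the bound.\<close>

lemma prime_height_le:
  fixes p q :: "('n::finite, 'k::{field, finite}) mvpoly set"
  assumes "is_prime_ideal q" "p \<subset> q"
  shows "prime_height p \<le> enat (CARD('n) - 1)"
  unfolding prime_height_def
proof (rule SUP_least)
  fix k assume "k \<in> {k. \<exists>c. is_prime_chain c k \<and> c k = p}"
  then obtain c where c: "is_prime_chain c k" "c k = p" by blast
  then have "is_prime_chain (c(Suc k := q)) (Suc k)"
    using assms unfolding is_prime_chain_def by (auto simp: le_Suc_eq less_Suc_eq)
  then show "enat k \<le> enat (CARD('n) - 1)" using prime_chain_length_le by fastforce
qed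

text \<open>The toric ideal lies strictly below the ideal of the origin: since all
  \<open>d i\<close> are positive, setting y = 0 in the parametrization is evaluation at the origin,
  and no variable lies in the toric ideal.\<close>

lemma prime_height_toric_ideal_le:
  fixes d :: "'n::finite \<Rightarrow> nat"
  assumes d: "\<And>i. 0 < d i"
  shows "prime_height (toric_ideal d :: ('n, 'k::{field, finite}) mvpoly set) \<le> enat (CARD('n) - 1)"
proof (rule prime_height_le)
  let ?e = "mv_eval (\<lambda>c. c) (\<lambda>_. 0) :: ('n, 'k) mvpoly \<Rightarrow> 'k"
  let ?t = "mv_eval (\<lambda>c. [:c:]) (\<lambda>i. Polynomial.monom 1 (d i)) :: ('n, 'k) mvpoly \<Rightarrow> 'k poly"
  have e: "ring_map ?e" by (rule ring_map_mv_eval[OF ring_map_ident])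
  show "is_prime_ideal {f. ?e f = 0}" by (rule is_prime_ideal_kernel[OF e]) simp
  have p: "ring_map (\<lambda>x. poly (?t x) 0)"
    by (rule ring_map_comp[OF ring_map_toric]) (simp add: ring_map_def)
  have pe: "poly (?t f) 0 = ?e f" for f
    by (rule ring_map_mv_ext[OF p e]) (simp_all add: mv_eval_const mv_eval_var ring_map_ident ring_map_pCons
        poly_monom d)
  have "?e f = 0" if "?t f = 0" for f
    unfolding pe[symmetric] that by simp
  then have "toric_ideal d \<subseteq> {f. ?e f = 0}" unfolding toric_ideal_def by blast
  moreover have "mv_var i \<in> {f. ?e f = 0} - toric_ideal d" for i
    by (simp add: toric_ideal_def mv_eval_var ring_map_ident ring_map_pCons)
  ultimately show "toric_ideal d \<subset> {f. ?e f = 0}" by blast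
qed

lemma is_prime_ideal_toric_ideal: "is_prime_ideal (toric_ideal d)"
  unfolding toric_ideal_def by (rule is_prime_ideal_kernel[OF ring_map_toric]) simp

text \<open>The chain of primes eliminates one variable after the other.\<close>

lemma ex_prime_height_ge:
  "\<exists>z::'n::finite. \<forall>c d (p :: ('n, 'k::field) mvpoly set).
    (\<forall>j. c j \<noteq> 0) \<and> (\<forall>j. 0 < d j) \<and> is_prime_ideal p \<and>
    {f. mv_eval mv_const (\<lambda>j. mv_const (c j) * mv_var z ^ d j :: ('n, 'k) mvpoly) f = 0} \<subseteq> p \<longrightarrow>
    enat (CARD('n) - 1) \<le> prime_height p"
proof -
  obtain idx :: "'n \<Rightarrow> nat" where idx: "bij_betw idx UNIV {0..<CARD('n)}"
    using ex_bij_betw_finite_nat[OF finite[of "UNIV :: 'n set"]] by blast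
  have idx_ex: "\<exists>j. idx j = m" if "m < CARD('n)" for m
  proof -
    have "m \<in> range idx" using bij_betw_imp_surj_on[OF idx] that by simp
    then show ?thesis by blast
  qed
  have idx_less: "idx j < CARD('n)" for j
    using bij_betwE[OF idx] by auto
  obtain z where z: "idx z = 0" using idx_ex[OF zero_less_card_finite] by blast
  show ?thesis
  proof (intro exI[of _ z] allI impI, elim conjE)
    fix c :: "'n \<Rightarrow> 'k" and d :: "'n \<Rightarrow> nat" and p :: "('n, 'k) mvpoly set"
    assume c: "\<forall>j. c j \<noteq> 0" and "\<forall>j. 0 < d j" and p: "is_prime_ideal p"
      and sub: "{f. mv_eval mv_const (\<lambda>j. mv_const (c j) * mv_var z ^ d j :: ('n, 'k) mvpoly) f = 0} \<subseteq> p"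
    then have d: "0 < d j" for j by blast
    let ?t = "\<lambda>j. mv_const (c j) * mv_var z ^ d j :: ('n, 'k) mvpoly"
    \<comment> \<open>Stage m replaces the variables with index at most m. The kernels for m from 0
      to \<open>CARD('n) - 1\<close> give \<open>CARD('n) - 1\<close> strict inclusions.\<close>
    define x where "x m j = (if idx j \<le> m then ?t j else mv_var j)" for m j
    define ch where "ch m = {f :: ('n, 'k) mvpoly. mv_eval mv_const (x m) f = 0}" for m
    note hom = ring_map_mv_mv_eval and var = mv_eval_var[OF ring_map_mv_const]
      and const = mv_eval_const[OF ring_map_mv_const]
    have prime: "is_prime_ideal (ch m)" for m
      unfolding ch_def by (rule is_prime_ideal_kernel[OF hom], rule mvpoly_no_zero_divisors)
    have less: "ch m \<subset> ch (Suc m)" if m: "Suc m < CARD('n)" for m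
    proof
      \<comment> \<open>Stage \<open>Suc m\<close> is stage m followed by the substitution of the
        next variable, which fixes t_z; so the kernels increase.\<close>
      let ?s = "\<lambda>j. if idx j = Suc m then ?t j else mv_var j"
      have comp: "mv_eval mv_const ?s (mv_eval mv_const (x m) f) = mv_eval mv_const (x (Suc m)) f" for f
      proof (rule ring_map_mv_ext[OF ring_map_comp[OF hom hom] hom])
        show "mv_eval mv_const ?s (mv_eval mv_const (x m) (mv_const a)) =
            mv_eval mv_const (x (Suc m)) (mv_const a)" for a
          by (simp only: const)
        have "mv_eval mv_const ?s (x m i) = x (Suc m) i" for i
        proof (cases "idx i \<le> m")
          case True
          then have "x m i = ?t i" "x (Suc m) i = ?t i" by (simp_all add: x_def)
          moreover have "?s z = mv_var z" using z by simp
          ultimately show ?thesis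
            by (simp only: ring_map_mult[OF hom] ring_map_power[OF hom] const var)
        next
          case False
          then have "x m i = mv_var i" "x (Suc m) i = ?s i" by (auto simp: x_def)
          then show ?thesis by (simp only: var)
        qed
        then show "mv_eval mv_const ?s (mv_eval mv_const (x m) (mv_var i)) =
            mv_eval mv_const (x (Suc m)) (mv_var i)" for i
          by (simp only: var)
      qed
      have "mv_eval mv_const (x (Suc m)) f = 0" if "mv_eval mv_const (x m) f = 0" for f
        unfolding comp[symmetric] that by (rule ring_map_zero[OF hom])
      then show "ch m \<subseteq> ch (Suc m)" unfolding ch_def by (intro Collect_mono impI)
      obtain j where j: "idx j = Suc m" using idx_ex m by blast
      have jz: "j \<noteq> z" using j z by auto
      let ?c = "c z ^ d j" and ?c' = "c j ^ d z"
      have t_power: "?t l ^ e = Poly_Mapping.single (Poly_Mapping.single z (d l * e)) (c l ^ e)" for l e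
        by (simp only: power_mult_distrib power_mult[symmetric] ring_map_power[OF ring_map_mv_const, symmetric])
          (simp only: mv_var_power mv_const_mult_monom)
      \<comment> \<open>The binomial relation between t_j and t_z that the new substitution imposes.
        The scalars cross over so that both terms become the same multiple of a power of t_z, while
        at stage m the variable t_j is still free.\<close>
      define w :: "('n, 'k) mvpoly" where
        "w = Poly_Mapping.single (Poly_Mapping.single j (d z)) ?c -
          Poly_Mapping.single (Poly_Mapping.single z (d j)) ?c'"
      have eval: "mv_eval mv_const (x l) w = mv_const ?c * x l j ^ d z - mv_const ?c' * x l z ^ d j" for l
        by (simp only: w_def ring_map_diff[OF hom] mv_eval_single[OF ring_map_mv_const] prod_power_single)
      have xz: "x l z = ?t z" for l by (simp only: x_def z le0 if_True)
      have "x (Suc m) j = ?t j" by (simp only: x_def j order_refl if_True)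
      then have "mv_eval mv_const (x (Suc m)) w = 0"
        by (simp only: eval xz t_power) (simp add: mv_const_def mult_single mult.commute)
      then have "w \<in> ch (Suc m)" by (simp add: ch_def)
      moreover have ne: "Poly_Mapping.single z e \<noteq> Poly_Mapping.single j (d z)" for e
      proof
        assume "Poly_Mapping.single z e = Poly_Mapping.single j (d z)"
        from arg_cong[OF this, of "\<lambda>a. Poly_Mapping.lookup a j"] show False
          using jz d[of z] by (simp add: lookup_single when_def)
      qed
      have "x m j = mv_var j" by (simp add: x_def j)
      then have "mv_eval mv_const (x m) w = Poly_Mapping.single (Poly_Mapping.single j (d z)) ?c -
          Poly_Mapping.single (Poly_Mapping.single z (d z * d j)) (?c' * ?c)"
        by (simp only: eval xz t_power)
          (simp add: mv_var_power mv_const_mult_monom, simp add: mv_const_def mult_single)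
      then have "Poly_Mapping.lookup (mv_eval mv_const (x m) w) (Poly_Mapping.single j (d z)) = ?c"
        using ne by (simp add: lookup_minus lookup_single)
      then have "w \<notin> ch m" using c by (auto simp: ch_def)
      ultimately show "ch m \<noteq> ch (Suc m)" by blast
    qed
    have "is_prime_chain ch (CARD('n) - 1)"
      unfolding is_prime_chain_def using prime less by simp
    then have "enat (CARD('n) - 1) \<le> prime_height (ch (CARD('n) - 1))"
      unfolding prime_height_def by (intro SUP_upper) blast
    also have "\<dots> \<le> prime_height p"
    proof (rule prime_height_mono[OF p])
      have "idx j \<le> CARD('n) - 1" for j using idx_less[of j] by linarith
      then have "x (CARD('n) - 1) = ?t" by (simp add: x_def fun_eq_iff)
      then show "ch (CARD('n) - 1) \<subseteq> p" using sub by (simp only: ch_def)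
    qed
    finally show "enat (CARD('n) - 1) \<le> prime_height p" .
  qed
qed

section \<open>Heights of the toric ideal and of the vanishing ideal\<close>

lemma height_eqI:
  assumes "is_prime_ideal p" "I \<subseteq> p" "prime_height p \<le> e"
    and "\<And>p. is_prime_ideal p \<Longrightarrow> I \<subseteq> p \<Longrightarrow> e \<le> prime_height p"
  shows "height I = e"
proof (rule antisym)
  have "height I \<le> prime_height p"
    unfolding height_def using assms(1,2) by (intro INF_lower) simp
  then show "height I \<le> e" using assms(3) by (rule order_trans)
  show "e \<le> height I" unfolding height_def using assms(4) by (intro INF_greatest) auto
qed

lemma height_toric_ideal:
  fixes d :: "'n::finite \<Rightarrow> nat"
  assumes d: "\<And>i. 0 < d i"
  shows "height (toric_ideal d :: ('n, 'k::{field, finite}) mvpoly set) = enat (CARD('n) - 1)"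
proof -
  let ?P = "toric_ideal d :: ('n, 'k) mvpoly set"
  obtain z where z: "\<forall>c d (p :: ('n, 'k) mvpoly set).
    (\<forall>j. c j \<noteq> 0) \<and> (\<forall>j. 0 < d j) \<and> is_prime_ideal p \<and>
    {f. mv_eval mv_const (\<lambda>j. mv_const (c j) * mv_var z ^ d j :: ('n, 'k) mvpoly) f = 0} \<subseteq> p \<longrightarrow>
    enat (CARD('n) - 1) \<le> prime_height p"
    using ex_prime_height_ge ..
  let ?\<phi> = "mv_eval mv_const (\<lambda>j. mv_const 1 * mv_var z ^ d j) :: ('n, 'k) mvpoly \<Rightarrow> ('n, 'k) mvpoly"
  let ?y = "mv_eval (\<lambda>c. [:c:]) (\<lambda>_. Polynomial.monom 1 1) :: ('n, 'k) mvpoly \<Rightarrow> 'k poly"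
  let ?t = "mv_eval (\<lambda>c. [:c:]) (\<lambda>i. Polynomial.monom 1 (d i)) :: ('n, 'k) mvpoly \<Rightarrow> 'k poly"
  \<comment> \<open>The parametrization factors through t_j -> t_z^(d j), followed by the map
    sending every variable to y. So the kernel of the first map lies in P.\<close>
  have y\<phi>: "?y (?\<phi> f) = ?t f" for f
    by (rule ring_map_mv_ext[OF ring_map_comp[OF ring_map_mv_mv_eval ring_map_toric] ring_map_toric])
      (simp_all add: mv_eval_const mv_eval_var ring_map_mv_const ring_map_pCons
        ring_map_mult[OF ring_map_toric] ring_map_power[OF ring_map_toric] monom_power one_pCons)
  have "?t f = 0" if "?\<phi> f = 0" for f
    unfolding y\<phi>[symmetric] that by (rule ring_map_zero[OF ring_map_toric])
  then have ker: "{f. ?\<phi> f = 0} \<subseteq> ?P"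
    unfolding toric_ideal_def by (intro Collect_mono impI)
  show ?thesis
  proof (rule height_eqI[OF is_prime_ideal_toric_ideal subset_refl prime_height_toric_ideal_le[OF d]])
    fix p :: "('n, 'k) mvpoly set"
    assume "is_prime_ideal p" "?P \<subseteq> p"
    then show "enat (CARD('n) - 1) \<le> prime_height p"
      by (intro z[rule_format, of "\<lambda>_. 1" d p] conjI order_trans[OF ker]) (simp_all add: d)
  qed
qed

text \<open>Needed to replace every variable by a scalar multiple of t_z modulo a prime.\<close>

lemma mv_eval_congruent:
  fixes f :: "('n::finite, 'k::comm_ring_1) mvpoly"
  assumes "is_ideal I" "ring_map \<phi>" "\<And>i. x i - y i \<in> I"
  shows "mv_eval \<phi> x f - mv_eval \<phi> y f \<in> I"
proof -
  have "mv_eval \<phi> x f - mv_eval \<phi> y f = (\<Sum>a\<in>Poly_Mapping.keys f. \<phi> (Poly_Mapping.lookup f a) *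
      ((\<Prod>i\<in>UNIV. x i ^ Poly_Mapping.lookup a i) - (\<Prod>i\<in>UNIV. y i ^ Poly_Mapping.lookup a i)))"
    by (simp add: mv_eval_def sum_subtractf right_diff_distrib)
  also have "\<dots> \<in> I"
    by (intro ideal_sum ideal_mult ideal_congruent_prod ideal_congruent_power assms)
  finally show ?thesis .
qed

lemma prime_ideal_prod:
  assumes "is_prime_ideal p" "finite A" "prod f A \<in> p"
  shows "\<exists>x\<in>A. f x \<in> p"
  using assms(2,3)
proof (induction A rule: finite_induct)
  case empty
  have id: "is_ideal p" using assms(1) by (simp add: is_prime_ideal_def)
  have "x \<in> p" for x using ideal_mult[OF id, of 1 x] empty by simp
  then show ?case using assms(1) by (auto simp: is_prime_ideal_def)
next
  case (insert a A)
  then show ?case using assms(1) unfolding is_prime_ideal_def by auto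
qed

lemma homogeneous_mult:
  fixes f g :: "('n::finite, 'k::comm_ring_1) mvpoly"
  assumes "homogeneous f" "homogeneous g"
  shows "homogeneous (f * g)"
proof -
  obtain e e' where "\<And>a. a \<in> Poly_Mapping.keys f \<Longrightarrow> (\<Sum>i\<in>UNIV. Poly_Mapping.lookup a i) = e"
    and "\<And>a. a \<in> Poly_Mapping.keys g \<Longrightarrow> (\<Sum>i\<in>UNIV. Poly_Mapping.lookup a i) = e'"
    using assms unfolding homogeneous_def by blast
  then have "\<forall>a\<in>Poly_Mapping.keys (f * g). (\<Sum>i\<in>UNIV. Poly_Mapping.lookup a i) = e + e'"
    using keys_mult[of f g] by (fastforce simp: lookup_add sum.distrib)
  then show ?thesis unfolding homogeneous_def by blast
qed

lemma homogeneous_prod: "(\<And>x. x \<in> A \<Longrightarrow> homogeneous (f x)) \<Longrightarrow> homogeneous (prod f A)"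
  by (induction A rule: infinite_finite_induct) (auto simp: homogeneous_mult, auto simp: homogeneous_def)

lemma homogeneous_linear_diff:
  "homogeneous (mv_var j - mv_const c * mv_var z :: ('n::finite, 'k::comm_ring_1) mvpoly)"
  unfolding homogeneous_def
proof (intro exI ballI)
  fix a assume "a \<in> Poly_Mapping.keys (mv_var j - mv_const c * mv_var z :: ('n, 'k) mvpoly)"
  then have "a = Poly_Mapping.single j 1 \<or> a = Poly_Mapping.single z 1"
    unfolding mv_var_def mv_const_mult_monom
    by (auto simp: mv_monom_def in_keys_iff lookup_minus lookup_single when_def split: if_splits)
  then show "(\<Sum>i\<in>UNIV. Poly_Mapping.lookup a i) = 1"
    using weight_single[of "\<lambda>_. 1" j 1] weight_single[of "\<lambda>_. 1" z 1] by (auto simp: weight_def)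
qed

text \<open>A prime containing \<open>I(X)\<close> contains some \<open>t j - c * t z\<close> with \<open>c \<noteq> 0\<close>, as the product of all
  of these vanishes on the torus; hence it contains the ideal of a point of the torus.\<close>

lemma height_vanishing_ideal_degenerate_torus:
  fixes \<beta> :: "'k::{field, finite}" and v d :: "'n::finite \<Rightarrow> nat"
  assumes \<beta>: "generates_units \<beta>" and d: "\<And>i. d i = mult_order (\<beta> ^ v i)"
  shows "height (vanishing_ideal (degenerate_torus v) :: ('n, 'k) mvpoly set) = enat (CARD('n) - 1)"
proof -
  let ?I = "vanishing_ideal (degenerate_torus v) :: ('n, 'k) mvpoly set"
  let ?one = "\<lambda>_::'n. 1::nat"
  obtain z where z: "\<forall>c d (p :: ('n, 'k) mvpoly set).
    (\<forall>j. c j \<noteq> 0) \<and> (\<forall>j. 0 < d j) \<and> is_prime_ideal p \<and>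
    {f. mv_eval mv_const (\<lambda>j. mv_const (c j) * mv_var z ^ d j :: ('n, 'k) mvpoly) f = 0} \<subseteq> p \<longrightarrow>
    enat (CARD('n) - 1) \<le> prime_height p"
    using ex_prime_height_ge ..
  \<comment> \<open>With all weights 1 the toric ideal is the ideal of the torus point with all
    coordinates 1. It is a prime over I(X) and supplies the upper bound on the height.\<close>
  have "?I \<subseteq> toric_ideal ?one"
    unfolding vanishing_ideal_degenerate_torus[OF \<beta> d] ideal_gen_subst_powers_toric_ideal
    by (intro ideal_gen_minimal is_ideal_toric_ideal)
      (auto simp only: monom_diff_mem_toric_ideal_iff weight_scale_exponent)
  then show ?thesis
  proof (rule height_eqI[OF is_prime_ideal_toric_ideal _ prime_height_toric_ideal_le])
    fix p :: "('n, 'k) mvpoly set"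
    assume p: "is_prime_ideal p" and Ip: "?I \<subseteq> p"
    have id: "is_ideal p" using p by (simp add: is_prime_ideal_def)
    have "\<exists>c. c \<noteq> 0 \<and> mv_var j - mv_const c * mv_var z \<in> p" for j
    proof -
      let ?l = "\<lambda>c. mv_var j - mv_const c * mv_var z :: ('n, 'k) mvpoly"
      let ?f = "\<Prod>c | c \<noteq> 0. ?l c"
      have hom: "homogeneous ?f" by (intro homogeneous_prod homogeneous_linear_diff)
      have "mv_eval (\<lambda>c. c) (\<lambda>i. x i ^ v i) ?f = 0" if "\<forall>i. x i \<noteq> 0" for x
      proof -
        note e = ring_map_mv_eval[OF ring_map_ident]
        have "mv_eval (\<lambda>c. c) (\<lambda>i. x i ^ v i) ?f = (\<Prod>c | c \<noteq> 0. x j ^ v j - c * x z ^ v z)"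
          by (simp add: ring_map_prod[OF e] ring_map_diff[OF e] ring_map_mult[OF e]
              mv_eval_var ring_map_ident mv_eval_const)
        \<comment> \<open>The factor whose c is the ratio of the two coordinates vanishes; this c is
          nonzero on the torus.\<close>
        also have "\<dots> = 0"
          using that by (intro prod_zero bexI[of _ "x j ^ v j / x z ^ v z"]) auto
        finally show ?thesis .
      qed
      then have "?f \<in> ?I"
        unfolding vanishing_ideal_def using hom vanishes_on_degenerate_torus_iff[OF hom]
        by (intro ideal_gen_base) blast
      then have "?f \<in> p" using Ip by blast
      from prime_ideal_prod[OF p _ this] show ?thesis by auto
    qed
    then obtain c where c: "\<And>j. c j \<noteq> 0" "\<And>j. mv_var j - mv_const (c j) * mv_var z \<in> p"
      by metis
    let ?\<phi> = "mv_eval mv_const (\<lambda>j. mv_const (c j) * mv_var z ^ 1) :: ('n, 'k) mvpoly \<Rightarrow> ('n, 'k) mvpoly"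
    have "f \<in> p" if "?\<phi> f = 0" for f
    proof -
      have "mv_eval mv_const mv_var f = f"
        by (rule ring_map_mv_ext[OF ring_map_mv_mv_eval ring_map_ident])
          (simp_all add: mv_eval_const mv_eval_var ring_map_mv_const)
      moreover have "mv_eval mv_const mv_var f - ?\<phi> f \<in> p"
        by (rule mv_eval_congruent[OF id ring_map_mv_const]) (use c(2) in simp)
      ultimately show ?thesis using that by simp
    qed
    then show "enat (CARD('n) - 1) \<le> prime_height p"
      by (intro z[rule_format, of c ?one p] conjI subsetI allI c(1) p) simp_all
  qed simp
qed

section \<open>Transfer of binomial generators between I(X) and P\<close>

theorem theorem3p6:
  fixes \<beta> :: "'k::{field, finite}" and v d :: "'n::finite \<Rightarrow> nat"
    and IX P :: "('n, 'k) mvpoly set"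
  assumes "\<And>i. 0 < v i"
    and "generates_units \<beta>"
    and "\<And>i. d i = mult_order (\<beta> ^ v i)"
    and "IX = vanishing_ideal (degenerate_torus v)"
    and "P = toric_ideal d"
  shows
    "(\<forall>h :: nat \<Rightarrow> ('n, 'k) mvpoly.
        complete_intersection IX \<and>
        (\<forall>i\<in>{1..CARD('n) - 1}. is_binomial (h i)) \<and>
        IX = ideal_gen (h ` {1..CARD('n) - 1}) \<longrightarrow>
        (\<exists>g :: nat \<Rightarrow> ('n, 'k) mvpoly.
           complete_intersection P \<and>
           (\<forall>i\<in>{1..CARD('n) - 1}. is_binomial (g i)) \<and>
           P = ideal_gen (g ` {1..CARD('n) - 1}) \<and>
           (\<forall>i\<in>{1..CARD('n) - 1}. h i = subst_powers d (g i)))) \<and>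
     (\<forall>g h :: nat \<Rightarrow> ('n, 'k) mvpoly.
        complete_intersection P \<and>
        (\<forall>i\<in>{1..CARD('n) - 1}. is_binomial (g i)) \<and>
        P = ideal_gen (g ` {1..CARD('n) - 1}) \<and>
        (\<forall>i\<in>{1..CARD('n) - 1}. h i = subst_powers d (g i)) \<longrightarrow>
        complete_intersection IX \<and>
        (\<forall>i\<in>{1..CARD('n) - 1}. is_binomial (h i)) \<and>
        IX = ideal_gen (h ` {1..CARD('n) - 1}))"
proof -
  let ?N = "{1..CARD('n) - 1}"
  have d: "0 < d i" for i
    using power_eq_power_iff_mod_mult_order(1)[of "\<beta> ^ v i"] generates_units_nonzero[OF assms(2)]
    by (simp add: assms(3))
  have IX: "IX = ideal_gen (subst_powers d ` P)"
    unfolding assms(4,5) by (rule vanishing_ideal_degenerate_torus[OF assms(2,3)])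
  have P: "ideal_gen P = P" unfolding assms(5) by (rule ideal_gen_ideal[OF is_ideal_toric_ideal])
  have "height IX = enat (CARD('n) - 1)"
    unfolding assms(4) by (rule height_vanishing_ideal_degenerate_torus[OF assms(2,3)])
  moreover have "height P = enat (CARD('n) - 1)"
    unfolding assms(5) by (rule height_toric_ideal[OF d])
  \<comment> \<open>Both heights equal the number of generators in \<open>?N\<close>, so generation
    by such a family is already the complete intersection property.\<close>
  ultimately have ci: "complete_intersection IX" "complete_intersection P"
    if "IX = ideal_gen (h ` ?N)" "P = ideal_gen (g ` ?N)" for g h :: "nat \<Rightarrow> ('n, 'k) mvpoly"
    using that unfolding complete_intersection_def by blast+
  \<comment> \<open>Freeness of the substitution makes generation of P by the g i equivalent to
    generation of I(X) by their images. Part (a) then only needs preimages of the h i.\<close>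
  have iff: "IX = ideal_gen (h ` ?N) \<longleftrightarrow> P = ideal_gen (g ` ?N)"
    if "\<forall>i\<in>?N. h i = subst_powers d (g i)" for g h :: "nat \<Rightarrow> ('n, 'k) mvpoly"
  proof -
    have "h ` ?N = subst_powers d ` g ` ?N" using that by (simp add: image_image)
    then show ?thesis using ideal_gen_subst_powers_eq_iff[of d P "g ` ?N", OF d] by (simp only: IX P)
  qed
  show ?thesis
  proof (intro conjI allI impI; (elim conjE)?)
    fix h :: "nat \<Rightarrow> ('n, 'k) mvpoly"
    assume bin: "\<forall>i\<in>?N. is_binomial (h i)" and gen: "IX = ideal_gen (h ` ?N)"
    have "\<forall>i\<in>?N. \<exists>g. is_binomial g \<and> h i = subst_powers d g"
      using binomial_generator_is_subst_powers[OF d, of h] bin gen IX assms(5) by auto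
    then obtain g where g: "\<forall>i\<in>?N. is_binomial (g i) \<and> h i = subst_powers d (g i)" by metis
    then have genP: "P = ideal_gen (g ` ?N)" using iff[of h g] gen by blast
    with gen have "complete_intersection P" by (rule ci(2))
    with genP g show "\<exists>g. complete_intersection P \<and> (\<forall>i\<in>?N. is_binomial (g i)) \<and>
        P = ideal_gen (g ` ?N) \<and> (\<forall>i\<in>?N. h i = subst_powers d (g i))"
      by blast
  next
    fix g h :: "nat \<Rightarrow> ('n, 'k) mvpoly"
    assume bin: "\<forall>i\<in>?N. is_binomial (g i)" and gen: "P = ideal_gen (g ` ?N)"
      and h: "\<forall>i\<in>?N. h i = subst_powers d (g i)"
    show IX: "IX = ideal_gen (h ` ?N)" using iff[OF h] gen by blast
    show "complete_intersection IX" by (rule ci(1)[OF IX gen])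
    show "\<forall>i\<in>?N. is_binomial (h i)" using bin h is_binomial_subst_powers by metis
  qed
qed

end
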